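(* Let $\omega$ be a strong weight and let $\psi:\mathbb{R}\to\mathbb{R}$ be a $C^\infty$ function such that $f\circ\psi\in\mathcal{S}_{(\omega)}(\mathbb{R})$ for every $f\in\mathcal{S}_{(\omega)}(\mathbb{R})$. Then the composition operator $C_\psi:\mathcal{S}_{(\omega)}(\mathbb{R})\to\mathcal{S}_{(\omega)}(\mathbb{R})$, $f\mapsto f\circ\psi$, is not a compact operator.
   Context: A weight is a continuous (weakly) increasing function $\omega:[0,\infty)\to[0,\infty)$ such that: $(\alpha)$ there is $K\ge 1$ with $\omega(2t)\le K(\omega(t)+1)$ for all $t\ge 0$; $(\beta)$ $\int_0^\infty \frac{\omega(t)}{1+t^2}\,dt<\infty$; $(\gamma)$ $\log(1+t^2)=o(\omega(t))$ as $t\to\infty$; $(\delta)$ $\varphi_\omega(t):=\omega(e^t)$ is convex on $\mathbb{R}$. It is extended to $\mathbb{R}$ by $\omega(x)=\omega(|x|)$. The weight is strong if moreover $(\varepsilon)$ there is $C\ge 1$ with $\int_1^\infty \frac{\omega(yt)}{t^2}\,dt\le C\omega(y)+C$ for all $y>0$. The Gelfand-Shilov space $\mathcal{S}_{(\omega)}(\mathbb{R})$ consists of the (complex-valued) functions $f\in L^1(\mathbb{R})$ such that $f,\widehat f\in C^\infty(\mathbb{R})$ ($\widehat f$ the Fourier transform) and, for all $\lambda>0$ and $j\in\mathbb{N}_0$, $q_{\lambda,j}(f):=\max\big(\sup_{x\in\mathbb{R}}|f^{(j)}(x)|e^{\lambda\omega(x)},\ \sup_{\xi\in\mathbb{R}}|\widehat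 f^{(j)}(\xi)|e^{\lambda\omega(\xi)}\big)<\infty$. It is a Fréchet space with the topology defined by the seminorms $q_{\lambda,j}$. With the Young conjugate $\varphi_\omega^*(s):=\sup\{st-\varphi_\omega(t): t\ge 0\}$, $s\ge 0$, equivalent systems of seminorms (defining the same space and topology) are $p_\lambda(f)=\sup_{j,k\in\mathbb{N}_0}\sup_{x}|x^kf^{(j)}(x)|e^{-\lambda\varphi_\omega^*(\frac{j+k}{\lambda})}$, $\lambda>0$, and $\pi_{\lambda,\mu}(f)=\sup_{j\in\mathbb{N}_0}\sup_{x}|f^{(j)}(x)|e^{-\lambda\varphi_\omega^*(\frac{j}{\lambda})+\mu\omega(x)}$, $\lambda,\mu>0$. A linear operator $T:E\to F$ between Fréchet spaces is compact if there is a $0$-neighborhood $U$ in $E$ such that $T(U)$ is relatively compact in $F$. *)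

theory Defs
  imports "HOL-Analysis.Analysis" "HOL-Library.Landau_Symbols"
begin

definition nth_deriv :: "nat \<Rightarrow> (real \<Rightarrow> 'a::real_normed_vector) \<Rightarrow> real \<Rightarrow> 'a" where
  "nth_deriv j f = ((\<lambda>g x. vector_derivative g (at x)) ^^ j) f"

definition smooth :: "(real \<Rightarrow> 'a::real_normed_vector) \<Rightarrow> bool" where
  "smooth f \<longleftrightarrow> (\<forall>j x. nth_deriv j f differentiable (at x))"

text \<open>Only the values of a weight on \<open>[0,\<infinity>)\<close> matter: its even extension to the whole line
  is written \<open>\<omega> \<bar>x\<bar>\<close>. The integrals are taken in the extended nonnegative reals, so that
  the inequalities for them include their convergence.\<close>

definition weight :: "(real \<Rightarrow> real) \<Rightarrow> bool" where
  "weight \<omega> \<longleftrightarrow>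
     continuous_on {0..} \<omega> \<and> mono_on {0..} \<omega> \<and> (\<forall>t\<ge>0. 0 \<le> \<omega> t) \<and>
     (\<exists>K\<ge>1. \<forall>t\<ge>0. \<omega> (2 * t) \<le> K * (\<omega> t + 1)) \<and>
     (\<integral>\<^sup>+t\<in>{0..}. ennreal (\<omega> t / (1 + t\<^sup>2)) \<partial>lborel) < \<infinity> \<and>
     (\<lambda>t. ln (1 + t\<^sup>2)) \<in> o[at_top](\<omega>) \<and>
     convex_on UNIV (\<lambda>t. \<omega> (exp t))"

definition strong_weight :: "(real \<Rightarrow> real) \<Rightarrow> bool" where
  "strong_weight \<omega> \<longleftrightarrow> weight \<omega> \<and>
     (\<exists>C\<ge>1. \<forall>y>0. (\<integral>\<^sup>+t\<in>{1..}. ennreal (\<omega> (y * t) / t\<^sup>2) \<partial>lborel) \<le> ennreal (C * \<omega> y + C))"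

text \<open>Other normalisations differ from this one by a dilation and a constant factor. By the
  doubling condition on the weight, and since all \<open>\<lambda> > 0\<close> occur, they lead to the same space
  with the same topology.\<close>

definition fourier :: "(real \<Rightarrow> complex) \<Rightarrow> real \<Rightarrow> complex" where
  "fourier f \<xi> = (LINT x|lborel. f x * exp (- (\<i> * of_real (x * \<xi>))))"

definition gs_seminorm :: "(real \<Rightarrow> real) \<Rightarrow> real \<Rightarrow> nat \<Rightarrow> (real \<Rightarrow> complex) \<Rightarrow> ennreal" where
  "gs_seminorm \<omega> l j f =
     max (SUP x. ennreal (norm (nth_deriv j f x) * exp (l * \<omega> \<bar>x\<bar>)))
         (SUP \<xi>. ennreal (norm (nth_deriv j (fourier f) \<xi>) * exp (l * \<omega> \<bar>\<xi>\<bar>)))"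

definition gelfand_shilov :: "(real \<Rightarrow> real) \<Rightarrow> (real \<Rightarrow> complex) set" where
  "gelfand_shilov \<omega> = {f. integrable lborel f \<and> smooth f \<and> smooth (fourier f) \<and>
     (\<forall>l>0. \<forall>j. gs_seminorm \<omega> l j f < \<infinity>)}"

text \<open>The locally convex topology given by the seminorms: the open seminorm balls form a
  subbasis.\<close>

definition gs_topology :: "(real \<Rightarrow> real) \<Rightarrow> (real \<Rightarrow> complex) topology" where
  "gs_topology \<omega> = topology_generated_by
     {{g \<in> gelfand_shilov \<omega>. gs_seminorm \<omega> l j (\<lambda>x. g x - f x) < ennreal e} |f l j e.
        f \<in> gelfand_shilov \<omega> \<and> 0 < l \<and> 0 < e}"

lemma topspace_gs_topology: "topspace (gs_topology \<omega>) = gelfand_shilov \<omega>"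
proof -
  have F: "fourier (\<lambda>x. 0) = (\<lambda>x. 0)"
    by (simp add: fourier_def fun_eq_iff)
  have D: "nth_deriv j (\<lambda>x. 0 :: complex) = (\<lambda>x. 0)" for j
    by (induction j) (simp_all add: nth_deriv_def)
  have Z: "gs_seminorm \<omega> l j (\<lambda>x. f x - f x) = 0" for l j f
    by (simp add: gs_seminorm_def F D)
  have "f \<in> topspace (gs_topology \<omega>)" if "f \<in> gelfand_shilov \<omega>" for f
    unfolding gs_topology_def topology_generated_by_topspace using that zero_less_one[where 'a = real]
    by (intro UnionI[of "{g \<in> gelfand_shilov \<omega>. gs_seminorm \<omega> 1 0 (\<lambda>x. g x - f x) < ennreal 1}"]
        CollectI exI[of _ f] exI[of _ "1::real"] exI[of _ "0::nat"] conjI refl) (simp_all only: Z ennreal_1 zero_less_one)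
  moreover have "topspace (gs_topology \<omega>) \<subseteq> gelfand_shilov \<omega>"
    unfolding gs_topology_def topology_generated_by_topspace by (intro Union_least) auto
  ultimately show ?thesis
    by blast
qed

definition relatively_compactin :: "'a topology \<Rightarrow> 'a set \<Rightarrow> bool" where
  "relatively_compactin X A \<longleftrightarrow> A \<subseteq> topspace X \<and> compactin X (X closure_of A)"

text \<open>Compactness of a linear operator between function spaces \<open>E\<close> and \<open>F\<close>, which are given by
  their topologies. Linearity is not part of the definition.\<close>

definition compact_operator ::
  "('a \<Rightarrow> 'b::zero) topology \<Rightarrow> 'c topology \<Rightarrow> (('a \<Rightarrow> 'b) \<Rightarrow> 'c) \<Rightarrow> bool" where
  "compact_operator E F T \<longleftrightarrow>
     (\<exists>U V. openin E V \<and> (\<lambda>x. 0) \<in> V \<and> V \<subseteq> U \<and> U \<subseteq> topspace E \<and> relatively_compactin F (T ` U))"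

end

(* Test the operator on the modulated Gaussians f_b(x) = exp(i b x - x^2/2).  Their seminorms grow
   at most like exp(L omega(b)), where L depends on the seminorm.  If C_psi mapped a 0-neighbourhood
   into a relatively compact, hence bounded, set, then g_b = f_b o psi would satisfy
   |FT g_b(xi)| <= N exp(L omega(b) - mu omega(xi)) with one fixed L and every mu (N depending on mu).
   Now |g_b| does not depend on b, while |g_b'| >= b |psi'| exp(-psi^2/2).  By Plancherel, the L^2 norm
   of g_b' is at most eta b times that of g_b plus the contribution of the frequencies |xi| > eta b.
   For small eta the first term is too small, and for large mu the second one stays bounded in b,
   by the doubling condition.  So psi' = 0, but then f_0 o psi is a nonzero constant and not
   integrable. *)

theory Submission
  imports Defs "HOL-Probability.Probability" "HOL-Real_Asymp.Real_Asymp"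
begin

text \<open>Continuity of the operator alone would be harmless: it allows the exponent L to grow
  with \<mu>, as it must for the identity, since the Gaussian modulated by b has its frequencies
  near b. Hence the order of the choices matters. The neighbourhood fixes L; \<psi> fixes the
  integrals \<open>A\<close> and \<open>\<kappa>\<close>, and these fix \<eta>; doubling compares
  \<omega>(b) with \<omega>(\<eta> b) and dictates \<mu>; only then is N drawn from compactness. The
  resulting decay leaves g_b almost no energy above the frequency \<eta> b, although its phase b
  \<psi>(x) oscillates at rate b \<psi>'(x). Weighing the L^2 norm of the derivative detects this
  conflict globally, without isolating an interval on which \<psi>' is large. Gaussians serve as
  test functions because they and their transforms lie in one explicit family, so that all
  derivatives are handled by polynomial factors. In the formal argument the Gaussian carries the
  factor exp(c0 - L \<omega>(b)), which places the whole family in the neighbourhood and cancels at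
  the end.\<close>

section \<open>Fourier inversion and Plancherel\<close>

lemma integrable_inverse_1_plus_square_lborel:
  "integrable lborel (\<lambda>x::real. inverse (1 + x\<^sup>2))"
  using integrable_inverse_1_plus_square by (simp add: set_integrable_def)

lemma integrable_fourier_integrand:
  assumes "integrable lborel f"
  shows "integrable lborel (\<lambda>x. f x * exp (- (\<i> * of_real (x * \<xi>))))"
proof (rule Bochner_Integration.integrable_bound[OF assms])
  have [measurable]: "f \<in> borel_measurable lborel" using assms by auto
  show "(\<lambda>x. f x * exp (- (\<i> * of_real (x * \<xi>)))) \<in> borel_measurable lborel" by measurable
qed (simp add: norm_mult)

text \<open>Fubini: the exponential kernel has modulus one and is symmetric in the two
  variables.\<close>

lemma fourier_multiplication_formula:
  assumes f: "integrable lborel f" and h: "integrable lborel h"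
  shows "(LINT \<xi>|lborel. fourier f \<xi> * h \<xi>) = (LINT x|lborel. f x * fourier h x)"
proof -
  have [measurable]: "f \<in> borel_measurable lborel" "h \<in> borel_measurable lborel"
    using f h by auto
  let ?F = "\<lambda>x \<xi>. f x * exp (- (\<i> * of_real (x * \<xi>))) * h \<xi>"
  have "integrable (lborel \<Otimes>\<^sub>M lborel) (case_prod ?F)"
  proof (rule lborel_pair.Fubini_integrable)
    show "case_prod ?F \<in> borel_measurable (lborel \<Otimes>\<^sub>M lborel)" by measurable
    show "integrable lborel (\<lambda>x. LINT \<xi>|lborel. norm (case (x, \<xi>) of (x, \<xi>) \<Rightarrow> ?F x \<xi>))"
      using f by (simp add: norm_mult)
    show "AE x in lborel. integrable lborel (\<lambda>\<xi>. case (x, \<xi>) of (x, \<xi>) \<Rightarrow> ?F x \<xi>)"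
    proof (rule AE_I2)
      fix x
      show "integrable lborel (\<lambda>\<xi>. case (x, \<xi>) of (x, \<xi>) \<Rightarrow> ?F x \<xi>)"
        using integrable_mult_right[OF integrable_fourier_integrand[OF h, of x], of "f x"]
        by (simp add: mult_ac)
    qed
  qed
  from lborel_pair.Fubini_integral[OF this]
  have 1: "(LINT \<xi>|lborel. LINT x|lborel. ?F x \<xi>) = (LINT x|lborel. LINT \<xi>|lborel. ?F x \<xi>)" .
  have 2: "(LINT x|lborel. ?F x \<xi>) = fourier f \<xi> * h \<xi>" for \<xi>
    unfolding fourier_def by simp
  have 3: "(LINT \<xi>|lborel. ?F x \<xi>) = f x * fourier h x" for x
  proof -
    have "(LINT \<xi>|lborel. ?F x \<xi>) = (LINT \<xi>|lborel. f x * (h \<xi> * exp (- (\<i> * of_real (\<xi> * x)))))"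
      by (intro Bochner_Integration.integral_cong) (auto simp: mult_ac)
    then show ?thesis unfolding fourier_def by simp
  qed
  show ?thesis using 1 unfolding 2 3 .
qed

lemma fourier_std_normal_density:
  "fourier (\<lambda>x. of_real (std_normal_density x)) \<xi> = of_real (exp (- \<xi>\<^sup>2 / 2))"
proof -
  have "fourier (\<lambda>x. of_real (std_normal_density x)) \<xi> = char std_normal_distribution (- \<xi>)"
    unfolding fourier_def char_def
    by (subst integral_density) (auto simp: scaleR_conv_of_real mult_ac)
  then show ?thesis by (simp add: char_std_normal_distribution)
qed

text \<open>Supplies the damping for the inversion integral. The transform is a bump of width
  \<open>e\<close> around \<open>x\<close> with total mass \<open>sqrt (2 * pi)\<close>, so up to
  this factor an approximate identity as \<open>e\<close> tends to 0.\<close>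

lemma fourier_scaled_normal:
  assumes "e > 0"
  shows "fourier (\<lambda>\<xi>. exp (\<i> * of_real (x * \<xi>)) * of_real (std_normal_density (e * \<xi>))) y
     = of_real (sqrt (2 * pi) / e * std_normal_density ((y - x) / e))"
proof -
  have "of_real (exp (- ((y - x) / e)\<^sup>2 / 2))
     = (LINT u|lborel. of_real (std_normal_density u) * exp (- (\<i> * of_real (u * ((y - x) / e)))))"
    using fourier_std_normal_density[of "(y - x) / e"] by (simp add: fourier_def)
  also have "\<dots> = \<bar>e\<bar> *\<^sub>R (LINT \<xi>|lborel. of_real (std_normal_density (0 + e * \<xi>)) *
      exp (- (\<i> * of_real ((0 + e * \<xi>) * ((y - x) / e)))))"
    using assms by (intro lborel_integral_real_affine) auto
  also have "(LINT \<xi>|lborel. of_real (std_normal_density (0 + e * \<xi>)) *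
      exp (- (\<i> * of_real ((0 + e * \<xi>) * ((y - x) / e))))) = 
      fourier (\<lambda>\<xi>. exp (\<i> * of_real (x * \<xi>)) * of_real (std_normal_density (e * \<xi>))) y"
    unfolding fourier_def
  proof (intro Bochner_Integration.integral_cong refl)
    fix \<xi>
    have "exp (- (\<i> * of_real ((0 + e * \<xi>) * ((y - x) / e))))
      = exp (\<i> * of_real (x * \<xi>) + - (\<i> * of_real (\<xi> * y)))"
      using assms by (intro arg_cong[where f = exp]) (simp add: field_simps flip: of_real_mult)
    then show "of_real (std_normal_density (0 + e * \<xi>)) * exp (- (\<i> * of_real ((0 + e * \<xi>) * ((y - x) / e))))
      = exp (\<i> * of_real (x * \<xi>)) * of_real (std_normal_density (e * \<xi>)) * exp (- (\<i> * of_real (\<xi> * y)))"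
      by (simp only: exp_add) (simp add: mult_ac)
  qed
  finally show ?thesis
    using assms by (simp add: std_normal_density_def scaleR_conv_of_real field_simps)
qed

lemma integrable_scaled_normal:
  assumes "e \<noteq> 0"
  shows "integrable lborel (\<lambda>\<xi>::real. exp (\<i> * of_real (x * \<xi>)) * of_real (std_normal_density (e * \<xi>)))"
proof (rule Bochner_Integration.integrable_bound)
  show "integrable lborel (\<lambda>\<xi>. std_normal_density (0 + e * \<xi>))"
    using assms by (intro lborel_integrable_real_affine) auto
qed (auto simp: norm_mult)

text \<open>Gaussian summation: the integral is damped by a Gaussian that flattens out as
  \<open>e n\<close> tends to 0. Dominated convergence applies on both sides, with majorant
  |\<open>fourier g\<close>| on the frequency side and \<open>B\<close> times the normal density on
  the other.\<close>

lemma fourier_inversion: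
  fixes g :: "real \<Rightarrow> complex"
  assumes g: "integrable lborel g" and cont: "continuous_on UNIV g" and bdd: "\<And>x. norm (g x) \<le> B"
    and Fg: "integrable lborel (fourier g)"
  shows "(LINT \<xi>|lborel. fourier g \<xi> * exp (\<i> * of_real (x * \<xi>))) = 2 * pi * g x"
proof -
  define e where "e = (\<lambda>n. inverse (real (Suc n)))"
  have e: "e n > 0" for n by (simp add: e_def)
  have e0: "e \<longlonglongrightarrow> 0" unfolding e_def by (rule LIMSEQ_inverse_real_of_nat)
  have [measurable]: "g \<in> borel_measurable lborel" "fourier g \<in> borel_measurable lborel"
    using g Fg by auto
  let ?w = "\<lambda>\<xi>::real. exp (\<i> * of_real (x * \<xi>))"
  \<comment> \<open>The multiplication formula moves the transform onto the damped exponential. The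
    substitution y = x + e u then leaves \<open>e n\<close> only in the argument of
    \<open>g\<close>, where continuity takes over.\<close>
  have eq: "(LINT \<xi>|lborel. fourier g \<xi> * (?w \<xi> * of_real (std_normal_density (e n * \<xi>))))
      = sqrt (2 * pi) * (LINT u|lborel. g (x + e n * u) * of_real (std_normal_density u))" for n
  proof -
    have "(LINT \<xi>|lborel. fourier g \<xi> * (?w \<xi> * of_real (std_normal_density (e n * \<xi>))))
      = (LINT y|lborel. g y * of_real (sqrt (2 * pi) / e n * std_normal_density ((y - x) / e n)))"
      unfolding fourier_scaled_normal[OF e, symmetric] using e[of n]
      by (intro fourier_multiplication_formula[OF g] integrable_scaled_normal) auto
    also have "\<dots> = \<bar>e n\<bar> *\<^sub>R (LINT u|lborel. g (x + e n * u) *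
        of_real (sqrt (2 * pi) / e n * std_normal_density ((x + e n * u - x) / e n)))"
      using e[of n] by (intro lborel_integral_real_affine) auto
    also have "(LINT u|lborel. g (x + e n * u) *
        of_real (sqrt (2 * pi) / e n * std_normal_density ((x + e n * u - x) / e n)))
      = (LINT u|lborel. (sqrt (2 * pi) / e n) * (g (x + e n * u) * of_real (std_normal_density u)))"
      using e[of n] by (intro Bochner_Integration.integral_cong) auto
    finally show ?thesis using e[of n] by (simp add: scaleR_conv_of_real)
  qed
  have "(\<lambda>n. LINT \<xi>|lborel. fourier g \<xi> * (?w \<xi> * of_real (std_normal_density (e n * \<xi>))))
    \<longlonglongrightarrow> (LINT \<xi>|lborel. fourier g \<xi> * (?w \<xi> * of_real (std_normal_density 0)))"
  proof (rule integral_dominated_convergence[where w = "\<lambda>\<xi>. norm (fourier g \<xi>)"])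
    show "AE \<xi> in lborel. (\<lambda>n. fourier g \<xi> * (?w \<xi> * of_real (std_normal_density (e n * \<xi>))))
        \<longlonglongrightarrow> fourier g \<xi> * (?w \<xi> * of_real (std_normal_density 0))"
      unfolding std_normal_density_def
      by (rule AE_I2) (auto intro!: tendsto_eq_intros e0)
    show "AE \<xi> in lborel. norm (fourier g \<xi> * (?w \<xi> * of_real (std_normal_density (e n * \<xi>))))
        \<le> norm (fourier g \<xi>)" for n
    proof (rule AE_I2)
      fix \<xi>
      have "sqrt (2 * pi) \<ge> 1" using pi_ge_two by (intro real_le_rsqrt) auto
      then have "std_normal_density (e n * \<xi>) \<le> 1"
        by (auto simp: std_normal_density_def field_simps intro: order_trans[of _ 1])
      then show "norm (fourier g \<xi> * (?w \<xi> * of_real (std_normal_density (e n * \<xi>)))) \<le> norm (fourier g \<xi>)"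
        by (auto simp: norm_mult intro!: mult_left_le)
    qed
  qed (use Fg in auto)
  moreover have "(\<lambda>n. sqrt (2 * pi) * (LINT u|lborel. g (x + e n * u) * of_real (std_normal_density u)))
    \<longlonglongrightarrow> sqrt (2 * pi) * (LINT u|lborel. g x * of_real (std_normal_density u))"
  proof (intro tendsto_mult tendsto_const integral_dominated_convergence[where w = "\<lambda>u. B * std_normal_density u"])
    show "AE u in lborel. (\<lambda>n. g (x + e n * u) * of_real (std_normal_density u)) \<longlonglongrightarrow> g x * of_real (std_normal_density u)"
    proof (intro AE_I2 tendsto_mult tendsto_const)
      fix u
      have "isCont g x" using cont by (simp add: continuous_on_eq_continuous_at)
      moreover have "(\<lambda>n. x + e n * u) \<longlonglongrightarrow> x" by (auto intro!: tendsto_eq_intros e0)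
      ultimately show "(\<lambda>n. g (x + e n * u)) \<longlonglongrightarrow> g x" by (rule isCont_tendsto_compose)
    qed
    show "AE u in lborel. norm (g (x + e n * u) * of_real (std_normal_density u)) \<le> B * std_normal_density u" for n
      using bdd by (auto simp: norm_mult intro!: mult_right_mono)
  qed auto
  ultimately have "(LINT \<xi>|lborel. fourier g \<xi> * (?w \<xi> * of_real (std_normal_density 0)))
    = sqrt (2 * pi) * (LINT u|lborel. g x * of_real (std_normal_density u))"
    unfolding eq using LIMSEQ_unique by blast
  moreover have "(LINT \<xi>|lborel. fourier g \<xi> * (?w \<xi> * of_real (std_normal_density 0)))
    = (LINT \<xi>|lborel. fourier g \<xi> * ?w \<xi>) / sqrt (2 * pi)"
    by (simp add: std_normal_density_def flip: mult.assoc)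
  moreover have "(LINT u|lborel. g x * of_real (std_normal_density u)) = g x"
    by simp
  \<comment> \<open>One factor \<open>sqrt (2 * pi)\<close> stems from the value of the damping
    density at 0, the other from the mass of the bump; their product is the 2 pi of the
    claim.\<close>
  ultimately have *: "(LINT \<xi>|lborel. fourier g \<xi> * ?w \<xi>) / of_real (sqrt (2 * pi)) = of_real (sqrt (2 * pi)) * g x"
    by (simp only:)
  have "(LINT \<xi>|lborel. fourier g \<xi> * ?w \<xi>)
      = (LINT \<xi>|lborel. fourier g \<xi> * ?w \<xi>) / of_real (sqrt (2 * pi)) * of_real (sqrt (2 * pi))"
    by simp
  also have "\<dots> = of_real (sqrt (2 * pi) * sqrt (2 * pi)) * g x"
    unfolding * by (simp only: of_real_mult mult_ac)
  also have "sqrt (2 * pi) * sqrt (2 * pi) = 2 * pi" by simp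
  finally show ?thesis .
qed

text \<open>By inversion, the transform of the conjugate of \<open>fourier g\<close> is 2 pi times
  the conjugate of \<open>g\<close>. The multiplication formula for \<open>g\<close> and that
  conjugate is then the claim.\<close>

lemma plancherel:
  fixes g :: "real \<Rightarrow> complex"
  assumes g: "integrable lborel g" and cont: "continuous_on UNIV g" and bdd: "\<And>x. norm (g x) \<le> B"
    and Fg: "integrable lborel (fourier g)"
  shows "(LINT \<xi>|lborel. (norm (fourier g \<xi>))\<^sup>2) = 2 * pi * (LINT x|lborel. (norm (g x))\<^sup>2)"
proof -
  have [measurable]: "g \<in> borel_measurable lborel" "fourier g \<in> borel_measurable lborel"
    using g Fg by auto
  have "fourier (\<lambda>\<xi>. cnj (fourier g \<xi>)) x = cnj (2 * pi * g x)" for x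
    unfolding fourier_inversion[OF assms, symmetric]
    by (simp add: fourier_def[of "\<lambda>\<xi>. cnj (fourier g \<xi>)"] exp_cnj mult_ac flip: Bochner_Integration.integral_cnj)
  then have "(LINT \<xi>|lborel. fourier g \<xi> * cnj (fourier g \<xi>)) = (LINT x|lborel. 2 * pi * (g x * cnj (g x)))"
    using Fg by (subst fourier_multiplication_formula[OF g]) (auto simp: mult_ac)
  then have "(LINT \<xi>|lborel. complex_of_real ((norm (fourier g \<xi>))\<^sup>2))
      = (LINT x|lborel. complex_of_real (2 * pi * (norm (g x))\<^sup>2))"
    by (simp only: complex_norm_square[symmetric] of_real_mult[symmetric])
  then show ?thesis
    by (simp only: integral_complex_of_real of_real_eq_iff integral_mult_right_zero)
qed

text \<open>\<open>?h\<close> is the derivative of \<open>g\<close> times the exponential; it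
  integrates to zero over the line because \<open>g\<close> vanishes at both ends.\<close>

lemma fourier_derivative:
  assumes g: "integrable lborel g" and g': "integrable lborel g'"
    and deriv: "\<And>x. (g has_vector_derivative g' x) (at x)"
    and cont: "continuous_on UNIV g'"
    and lim: "(g \<longlongrightarrow> 0) at_top" "(g \<longlongrightarrow> 0) at_bot"
  shows "fourier g' \<xi> = \<i> * of_real \<xi> * fourier g \<xi>"
proof -
  let ?w = "\<lambda>x::real. exp (- (\<i> * of_real (x * \<xi>)))"
  let ?h = "\<lambda>x. g' x * ?w x - \<i> * of_real \<xi> * (g x * ?w x)"
  have w: "(?w has_vector_derivative - (\<i> * of_real \<xi>) * ?w x) (at x)" for x
  proof -
    have "((\<lambda>x. - (\<i> * of_real (x * \<xi>))) has_vector_derivative - (\<i> * of_real \<xi>)) (at x)"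
      by (auto intro!: derivative_eq_intros simp: has_vector_derivative_def scaleR_conv_of_real)
    from field_vector_diff_chain_at[OF this DERIV_exp] show ?thesis by (simp add: o_def)
  qed
  have int: "integrable lborel (\<lambda>x. g' x * ?w x)" "integrable lborel (\<lambda>x. \<i> * of_real \<xi> * (g x * ?w x))"
    using integrable_fourier_integrand[OF g'] integrable_fourier_integrand[OF g] by auto
  have "continuous_on UNIV g"
    by (intro continuous_at_imp_continuous_on ballI has_vector_derivative_continuous[OF deriv])
  then have h: "continuous_on UNIV ?h"
    using cont by (intro continuous_intros)
  have 0: "((\<lambda>x. g x * ?w x) \<longlongrightarrow> 0) at_top" "((\<lambda>x. g x * ?w x) \<longlongrightarrow> 0) at_bot"
    by (rule tendsto_norm_zero_cancel, use lim in \<open>simp add: norm_mult tendsto_norm_zero\<close>)+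
  have "(LBINT x=-\<infinity>..\<infinity>. ?h x) = 0 - 0"
  proof (rule interval_integral_FTC_integrable)
    fix x :: real
    show "((\<lambda>x. g x * ?w x) has_vector_derivative ?h x) (at x)"
      using has_vector_derivative_mult[OF deriv[of x] w[of x]] by (simp add: algebra_simps)
    show "isCont ?h x" using h by (simp add: continuous_on_eq_continuous_at)
    show "set_integrable lborel (einterval (-\<infinity>) \<infinity>) ?h"
      using int by (auto simp: set_integrable_def)
  qed (use 0 in \<open>auto simp: ereal_tendsto_simps\<close>)
  then have "(LINT x|lborel. ?h x) = 0"
    by (simp add: interval_lebesgue_integral_def set_lebesgue_integral_def)
  then show ?thesis using int by (simp add: fourier_def)
qed

section \<open>Growth of weights\<close>

lemma weight_doubling_power:
  assumes "weight \<omega>"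
  shows "\<exists>C\<ge>1. \<forall>t\<ge>0. \<omega> (2 ^ m * t) \<le> C * (\<omega> t + 1)"
proof (induction m)
  case 0
  show ?case by (intro exI[of _ 1]) auto
next
  case (Suc m)
  then obtain C where C: "C \<ge> 1" "\<And>t. t \<ge> 0 \<Longrightarrow> \<omega> (2 ^ m * t) \<le> C * (\<omega> t + 1)" by auto
  obtain K where K: "K \<ge> 1" "\<And>t. t \<ge> 0 \<Longrightarrow> \<omega> (2 * t) \<le> K * (\<omega> t + 1)"
    using assms by (auto simp: weight_def)
  have nonneg: "\<omega> t \<ge> 0" if "t \<ge> 0" for t using assms that by (auto simp: weight_def)
  show ?case
  \<comment> \<open>The factor 2 absorbs the additive 1 of the doubling condition, as 1 \<le> C
    (\<omega> t + 1).\<close>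
  proof (intro exI[of _ "2 * K * C"] conjI allI impI)
    have "1 * 1 \<le> K * C" using C(1) K(1) by (intro mult_mono) auto
    then show "1 \<le> 2 * K * C" by simp
    fix t :: real assume t: "t \<ge> 0"
    have "\<omega> (2 ^ Suc m * t) \<le> K * (\<omega> (2 ^ m * t) + 1)" using K(2)[of "2 ^ m * t"] t by (simp add: mult_ac)
    also have "\<dots> \<le> K * (C * (\<omega> t + 1) + C * (\<omega> t + 1))"
    proof (intro mult_left_mono add_mono C(2) t)
      have "1 * 1 \<le> C * (\<omega> t + 1)" using C(1) nonneg[OF t] by (intro mult_mono) auto
      then show "1 \<le> C * (\<omega> t + 1)" by simp
    qed (use K in auto)
    finally show "\<omega> (2 ^ Suc m * t) \<le> 2 * K * C * (\<omega> t + 1)" by (simp add: algebra_simps)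
  qed
qed

text \<open>Lets decay at the cut-off frequency \<eta> b be read as decay in \<omega>(b): doubling
  is iterated until 2^m exceeds 1/\<eta>.\<close>

lemma weight_dilation:
  assumes "weight \<omega>" "\<eta> > 0"
  shows "\<exists>C\<ge>1. \<forall>t\<ge>0. \<omega> t \<le> C * (\<omega> (\<eta> * t) + 1)"
proof -
  obtain m where m: "1 / \<eta> < 2 ^ m" using real_arch_pow[of 2 "1 / \<eta>"] by auto
  obtain C where C: "C \<ge> 1" "\<And>t. t \<ge> 0 \<Longrightarrow> \<omega> (2 ^ m * t) \<le> C * (\<omega> t + 1)"
    using weight_doubling_power[OF assms(1)] by blast
  have mono: "mono_on {0..} \<omega>" using assms by (auto simp: weight_def)
  show ?thesis
  proof (intro exI[of _ C] conjI allI impI C(1))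
    fix t :: real assume t: "t \<ge> 0"
    have "1 * t \<le> (2 ^ m * \<eta>) * t" using m assms(2) t by (intro mult_right_mono) (auto simp: field_simps)
    then have "\<omega> t \<le> \<omega> (2 ^ m * (\<eta> * t))"
      using t assms(2) by (intro mono_onD[OF mono]) (auto simp: mult_ac)
    also have "\<dots> \<le> C * (\<omega> (\<eta> * t) + 1)" using t assms(2) by (intro C(2)) auto
    finally show "\<omega> t \<le> C * (\<omega> (\<eta> * t) + 1)" .
  qed
qed

text \<open>A substitute for subadditivity: |s + t| is at most twice the larger of |s| and |t|, so
  one doubling suffices.\<close>

lemma weight_add:
  assumes "weight \<omega>"
  shows "\<exists>K\<ge>1. \<forall>s t. \<omega> \<bar>s + t\<bar> \<le> K * (\<omega> \<bar>s\<bar> + \<omega> \<bar>t\<bar> + 1)"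
proof -
  obtain K where K: "K \<ge> 1" "\<And>t. t \<ge> 0 \<Longrightarrow> \<omega> (2 * t) \<le> K * (\<omega> t + 1)"
    using assms by (auto simp: weight_def)
  have nonneg: "\<omega> t \<ge> 0" if "t \<ge> 0" for t using assms that by (auto simp: weight_def)
  have mono: "mono_on {0..} \<omega>" using assms by (auto simp: weight_def)
  show ?thesis
  proof (intro exI[of _ K] conjI allI K(1))
    fix s t :: real
    have "\<omega> \<bar>s + t\<bar> \<le> \<omega> (2 * max \<bar>s\<bar> \<bar>t\<bar>)" by (intro mono_onD[OF mono]) auto
    also have "\<dots> \<le> K * (\<omega> (max \<bar>s\<bar> \<bar>t\<bar>) + 1)" by (intro K(2)) auto
    also have "\<dots> \<le> K * (\<omega> \<bar>s\<bar> + \<omega> \<bar>t\<bar> + 1)"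
      using K(1) nonneg[of "\<bar>s\<bar>"] nonneg[of "\<bar>t\<bar>"] by (intro mult_left_mono) (auto simp: max_def)
    finally show "\<omega> \<bar>s + t\<bar> \<le> K * (\<omega> \<bar>s\<bar> + \<omega> \<bar>t\<bar> + 1)" .
  qed
qed

text \<open>By monotonicity the integrand of condition (\<beta>) is at least \<omega>(t)/(5 t^2) on
  [t, 2t] for t \<ge> 1. This interval has length t, so the finite integral bounds
  \<omega>(t)/t.\<close>

lemma weight_le_linear:
  assumes "weight \<omega>"
  shows "\<exists>C\<ge>0. \<forall>t\<ge>0. \<omega> t \<le> C * (1 + t)"
proof -
  have mono: "mono_on {0..} \<omega>" using assms by (auto simp: weight_def)
  have nonneg: "\<omega> t \<ge> 0" if "t \<ge> 0" for t using assms that by (auto simp: weight_def)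
  define J where "J = (\<integral>\<^sup>+t\<in>{0..}. ennreal (\<omega> t / (1 + t\<^sup>2)) \<partial>lborel)"
  have "J < \<infinity>" using assms by (auto simp: weight_def J_def)
  then obtain I where I: "I \<ge> 0" "J = ennreal I" by (cases J rule: ennreal_cases) auto
  have *: "\<omega> t \<le> 5 * I * t" if t: "t \<ge> 1" for t
  proof -
    have "ennreal (\<omega> t / (5 * t\<^sup>2) * t) = (\<integral>\<^sup>+s. ennreal (\<omega> t / (5 * t\<^sup>2)) * indicator {t..2*t} s \<partial>lborel)"
      using t nonneg[of t] by (subst nn_integral_cmult_indicator) (auto simp flip: ennreal_mult)
    also have "\<dots> \<le> J"
      unfolding J_def
    proof (intro nn_integral_mono)
      fix s :: real
      show "ennreal (\<omega> t / (5 * t\<^sup>2)) * indicator {t..2*t} s \<le> ennreal (\<omega> s / (1 + s\<^sup>2)) * indicator {0..} s"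
      proof (cases "s \<in> {t..2*t}")
        case True
        have "1 \<le> t\<^sup>2" using t by simp
        moreover have "s\<^sup>2 \<le> (2*t)\<^sup>2" using True t by (intro power_mono) auto
        ultimately have "1 + s\<^sup>2 \<le> 5 * t\<^sup>2" by (simp add: power_mult_distrib)
        moreover have "\<omega> t \<le> \<omega> s" using True t by (intro mono_onD[OF mono]) auto
        ultimately have "\<omega> t / (5 * t\<^sup>2) \<le> \<omega> s / (1 + s\<^sup>2)"
          using nonneg[of t] t by (intro frac_le) (auto simp: add_pos_nonneg)
        then show ?thesis using True t by (auto intro: ennreal_leI)
      qed auto
    qed
    finally have "\<omega> t / (5 * t\<^sup>2) * t \<le> I" using I by simp
    then show ?thesis using t by (simp add: field_simps power2_eq_square)
  qed
  show ?thesis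
  proof (intro exI[of _ "\<omega> 1 + 5 * I"] conjI allI impI)
    fix t :: real assume t: "t \<ge> 0"
    show "\<omega> t \<le> (\<omega> 1 + 5 * I) * (1 + t)"
    proof (cases "t \<ge> 1")
      case True
      have "0 \<le> \<omega> 1 * t" "0 \<le> \<omega> 1" using nonneg[of 1] t by auto
      then show ?thesis using *[OF True] I(1) by (simp add: algebra_simps)
    next
      case False
      then have "\<omega> t \<le> \<omega> 1" using t by (intro mono_onD[OF mono]) auto
      moreover have "0 \<le> \<omega> 1 * t" "0 \<le> I * t" using nonneg[of 1] I(1) t by auto
      ultimately show ?thesis using I(1) by (simp add: algebra_simps)
    qed
  qed (use I nonneg[of 1] in auto)
qed

lemma power_le_exp_weight:
  assumes "weight \<omega>"
  shows "\<exists>C>0. \<forall>t\<ge>0. (1 + t) ^ n \<le> C * exp (\<omega> t)"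
proof -
  have nonneg: "\<omega> t \<ge> 0" if "t \<ge> 0" for t using assms that by (auto simp: weight_def)
  have "(\<lambda>t. ln (1 + t\<^sup>2)) \<in> o[at_top](\<omega>)" using assms by (auto simp: weight_def)
  \<comment> \<open>The small constant is 1/(n+1) instead of 1/n in order to include n = 0.\<close>
  then have "\<forall>\<^sub>F t in at_top. norm (ln (1 + t\<^sup>2)) \<le> 1 / real (Suc n) * norm (\<omega> t)"
    by (rule landau_o.smallD) auto
  then obtain T where T: "\<And>t. t \<ge> T \<Longrightarrow> norm (ln (1 + t\<^sup>2)) \<le> 1 / real (Suc n) * norm (\<omega> t)"
    by (auto simp: eventually_at_top_linorder)
  define C where "C = 2 ^ n * max 1 ((1 + \<bar>T\<bar>\<^sup>2) ^ n)"
  have le: "(1 + t) ^ n \<le> 2 ^ n * (1 + t\<^sup>2) ^ n" if "t \<ge> 0" for t :: real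
  proof -
    \<comment> \<open>This is 8 times 2 (1 + t^2) - (1 + t), with the square completed.\<close>
    have "0 \<le> (4 * t - 1)\<^sup>2 + 7" by simp
    then have "1 + t \<le> 2 * (1 + t\<^sup>2)" by (simp add: power2_eq_square algebra_simps)
    then have "(1 + t) ^ n \<le> (2 * (1 + t\<^sup>2)) ^ n" using that by (intro power_mono) auto
    then show ?thesis by (simp only: power_mult_distrib)
  qed
  show ?thesis
  proof (intro exI[of _ C] conjI allI impI)
    show "C > 0" by (auto simp: C_def add_pos_nonneg)
    fix t :: real assume t: "t \<ge> 0"
    have "(1 + t\<^sup>2) ^ n \<le> max 1 ((1 + \<bar>T\<bar>\<^sup>2) ^ n) * exp (\<omega> t)"
    proof (cases "t \<ge> T")
      case True
      have "real n * ln (1 + t\<^sup>2) \<le> real (Suc n) * ln (1 + t\<^sup>2)" by (intro mult_right_mono) auto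
      also have "\<dots> \<le> real (Suc n) * (1 / real (Suc n) * norm (\<omega> t))"
        using T[OF True] by (intro mult_left_mono) auto
      also have "\<dots> = \<omega> t" using nonneg[OF t] by simp
      finally have "exp (real n * ln (1 + t\<^sup>2)) \<le> exp (\<omega> t)" by simp
      moreover have "exp (real n * ln (1 + t\<^sup>2)) = (1 + t\<^sup>2) ^ n"
        by (simp add: exp_of_nat_mult add_pos_nonneg)
      ultimately have "1 * (1 + t\<^sup>2) ^ n \<le> max 1 ((1 + \<bar>T\<bar>\<^sup>2) ^ n) * exp (\<omega> t)"
        by (intro mult_mono) auto
      then show ?thesis by simp
    next
      case False
      then have "(1 + t\<^sup>2) ^ n \<le> (1 + \<bar>T\<bar>\<^sup>2) ^ n"
        using t by (intro power_mono add_left_mono) auto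
      then have "(1 + t\<^sup>2) ^ n * 1 \<le> max 1 ((1 + \<bar>T\<bar>\<^sup>2) ^ n) * exp (\<omega> t)"
        using nonneg[OF t] by (intro mult_mono) auto
      then show ?thesis by simp
    qed
    then have "2 ^ n * (1 + t\<^sup>2) ^ n \<le> 2 ^ n * (max 1 ((1 + \<bar>T\<bar>\<^sup>2) ^ n) * exp (\<omega> t))"
      by (intro mult_left_mono) auto
    from order_trans[OF le[OF t] this] show "(1 + t) ^ n \<le> C * exp (\<omega> t)"
      by (simp only: C_def mult.assoc)
  qed
qed

text \<open>The polynomial is bounded by a multiple of exp(\<omega>), and \<omega> grows at most
  linearly, so the exponent is a linear term minus x^2/2.\<close>

lemma gaussian_beats_weight:
  assumes "weight \<omega>" "l \<ge> 0"
  shows "\<exists>C>0. \<forall>x. (1 + \<bar>x\<bar>) ^ n * exp (- x\<^sup>2 / 2) * exp (l * \<omega> \<bar>x\<bar>) \<le> C"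
proof -
  obtain C where C: "C > 0" "\<And>t. t \<ge> 0 \<Longrightarrow> (1 + t) ^ n \<le> C * exp (\<omega> t)"
    using power_le_exp_weight[OF assms(1)] by blast
  obtain D where D: "D \<ge> 0" "\<And>t. t \<ge> 0 \<Longrightarrow> \<omega> t \<le> D * (1 + t)"
    using weight_le_linear[OF assms(1)] by blast
  \<comment> \<open>One copy of \<omega> pays for the polynomial, \<open>l\<close> copies for the
    weight.\<close>
  define L where "L = (l + 1) * D"
  show ?thesis
  proof (intro exI[of _ "C * exp (L + L\<^sup>2 / 2)"] conjI allI)
    fix x :: real
    have "\<omega> \<bar>x\<bar> + l * \<omega> \<bar>x\<bar> = (l + 1) * \<omega> \<bar>x\<bar>" by (simp add: algebra_simps)
    also have "\<dots> \<le> (l + 1) * (D * (1 + \<bar>x\<bar>))" using assms(2) by (intro mult_left_mono D(2)) auto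
    also have "\<dots> = L + L * \<bar>x\<bar>" by (simp add: L_def algebra_simps)
    finally have 1: "\<omega> \<bar>x\<bar> + l * \<omega> \<bar>x\<bar> \<le> L + L * \<bar>x\<bar>" .
    have "0 \<le> (\<bar>x\<bar> - L)\<^sup>2" by simp
    then have "L * \<bar>x\<bar> \<le> x\<^sup>2 / 2 + L\<^sup>2 / 2" by (simp add: power2_eq_square algebra_simps)
    with 1 have 2: "\<omega> \<bar>x\<bar> - x\<^sup>2 / 2 + l * \<omega> \<bar>x\<bar> \<le> L + L\<^sup>2 / 2" by simp
    have "(1 + \<bar>x\<bar>) ^ n * exp (- x\<^sup>2 / 2) * exp (l * \<omega> \<bar>x\<bar>)
      \<le> C * exp (\<omega> \<bar>x\<bar>) * exp (- x\<^sup>2 / 2) * exp (l * \<omega> \<bar>x\<bar>)"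
      by (intro mult_right_mono C(2)) auto
    also have "\<dots> = C * exp (\<omega> \<bar>x\<bar> - x\<^sup>2 / 2 + l * \<omega> \<bar>x\<bar>)"
      by (simp add: mult.assoc flip: exp_add)
    also have "\<dots> \<le> C * exp (L + L\<^sup>2 / 2)"
      using 2 C(1) by (intro mult_left_mono) auto
    finally show "(1 + \<bar>x\<bar>) ^ n * exp (- x\<^sup>2 / 2) * exp (l * \<omega> \<bar>x\<bar>) \<le> C * exp (L + L\<^sup>2 / 2)" .
  qed (use C in auto)
qed

section \<open>Iterated derivatives and modulated Gaussians\<close>

lemma nth_deriv_0 [simp]: "nth_deriv 0 f = f"
  by (simp add: nth_deriv_def)

lemma nth_deriv_Suc: "nth_deriv (Suc j) f = (\<lambda>x. vector_derivative (nth_deriv j f) (at x))"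
  by (simp add: nth_deriv_def)

lemma smooth_has_vector_derivative:
  assumes "smooth f"
  shows "(nth_deriv j f has_vector_derivative nth_deriv (Suc j) f x) (at x)"
  using assms by (simp add: smooth_def nth_deriv_Suc vector_derivative_works)

lemma smooth_nth_deriv_continuous:
  assumes "smooth f"
  shows "continuous_on A (nth_deriv j f)"
  by (intro continuous_at_imp_continuous_on ballI
      has_vector_derivative_continuous[OF smooth_has_vector_derivative[OF assms]])

lemma nth_deriv_diff:
  assumes "smooth f" "smooth g"
  shows "nth_deriv j (\<lambda>x. f x - g x) = (\<lambda>x. nth_deriv j f x - nth_deriv j g x)"
proof (induction j)
  case (Suc j)
  show ?case
    unfolding nth_deriv_Suc[of j "\<lambda>x. f x - g x"] Suc
    by (intro ext vector_derivative_at has_vector_derivative_diff smooth_has_vector_derivative assms)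
qed simp

lemma smooth_zero: "smooth (\<lambda>x. 0)"
proof -
  have "nth_deriv j (\<lambda>x. 0 :: 'a) = (\<lambda>x. 0)" for j
    by (induction j) (simp_all add: nth_deriv_Suc)
  then show ?thesis by (simp add: smooth_def)
qed

lemma fourier_diff:
  assumes "integrable lborel f" "integrable lborel g"
  shows "fourier (\<lambda>x. f x - g x) = (\<lambda>\<xi>. fourier f \<xi> - fourier g \<xi>)"
  using integrable_fourier_integrand[OF assms(1)] integrable_fourier_integrand[OF assms(2)]
  by (simp add: fourier_def algebra_simps fun_eq_iff)

text \<open>For \<open>\<beta> = \<i> b\<close> this is a modulated Gaussian; its Fourier transform is in the same family,
  with real \<open>\<beta>\<close>. The constant \<open>\<gamma>\<close> absorbs scalar factors.\<close>

definition gauss :: "complex \<Rightarrow> complex \<Rightarrow> real \<Rightarrow> complex" where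
  "gauss \<beta> \<gamma> x = exp (\<gamma> + \<beta> * of_real x - of_real (x\<^sup>2 / 2))"

lemma gauss_has_vector_derivative:
  "(gauss \<beta> \<gamma> has_vector_derivative (\<beta> - of_real x) * gauss \<beta> \<gamma> x) (at x)"
proof -
  have "((\<lambda>x. \<gamma> + \<beta> * of_real x - of_real (x\<^sup>2 / 2)) has_vector_derivative (\<beta> - of_real x)) (at x)"
    by (auto intro!: derivative_eq_intros
        simp: has_vector_derivative_def scaleR_conv_of_real algebra_simps)
  from field_vector_diff_chain_at[OF this DERIV_exp] show ?thesis
    by (simp add: o_def gauss_def[abs_def])
qed

lemma poly_gauss_has_vector_derivative:
  "((\<lambda>x. poly p (\<beta> - of_real x) * gauss \<beta> \<gamma> x) has_vector_derivative
     poly (pCons 0 p - pderiv p) (\<beta> - of_real x) * gauss \<beta> \<gamma> x) (at x)"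
proof -
  have "((\<lambda>x. \<beta> - of_real x) has_vector_derivative -1) (at x)"
    by (auto intro!: derivative_eq_intros simp: has_vector_derivative_def scaleR_conv_of_real)
  from field_vector_diff_chain_at[OF this poly_DERIV]
  have "((\<lambda>x. poly p (\<beta> - of_real x)) has_vector_derivative - poly (pderiv p) (\<beta> - of_real x)) (at x)"
    by (simp add: o_def)
  from has_vector_derivative_mult[OF this gauss_has_vector_derivative] show ?thesis
    by (simp add: algebra_simps)
qed

text \<open>The polynomial depends on \<open>j\<close> alone, which makes the later estimates
  uniform in the modulation. Each differentiation replaces p by X p - p': the factor X comes from
  the Gaussian, the minus sign from the inner function \<beta> - x.\<close>

lemma nth_deriv_gauss:
  "\<exists>p. \<forall>\<beta> \<gamma>. nth_deriv j (gauss \<beta> \<gamma>) = (\<lambda>x. poly p (\<beta> - of_real x) * gauss \<beta> \<gamma> x)"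
proof (induction j)
  case 0
  show ?case by (intro exI[of _ 1]) auto
next
  case (Suc j)
  then obtain p where p: "\<And>\<beta> \<gamma>. nth_deriv j (gauss \<beta> \<gamma>) = (\<lambda>x. poly p (\<beta> - of_real x) * gauss \<beta> \<gamma> x)"
    by auto
  have "nth_deriv (Suc j) (gauss \<beta> \<gamma>)
      = (\<lambda>x. poly (pCons 0 p - pderiv p) (\<beta> - of_real x) * gauss \<beta> \<gamma> x)" for \<beta> \<gamma>
    unfolding nth_deriv_Suc p
    by (intro ext vector_derivative_at poly_gauss_has_vector_derivative)
  then show ?case by blast
qed

lemma smooth_gauss: "smooth (gauss \<beta> \<gamma>)"
  unfolding smooth_def
proof (intro allI)
  fix j x
  obtain p where p: "nth_deriv j (gauss \<beta> \<gamma>) = (\<lambda>x. poly p (\<beta> - of_real x) * gauss \<beta> \<gamma> x)"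
    using nth_deriv_gauss by blast
  show "nth_deriv j (gauss \<beta> \<gamma>) differentiable at x"
    unfolding p by (rule differentiableI_vector[OF poly_gauss_has_vector_derivative])
qed

lemma norm_gauss_imaginary: "norm (gauss (\<i> * of_real b) (of_real c) x) = exp c * exp (- x\<^sup>2 / 2)"
  by (simp add: gauss_def flip: exp_add)

lemma norm_gauss_real: "norm (gauss (of_real b) (of_real c) x) = exp (c + b\<^sup>2 / 2) * exp (- (b - x)\<^sup>2 / 2)"
  by (simp add: gauss_def power2_eq_square field_simps flip: exp_add)

lemma integrable_gauss_imaginary: "integrable lborel (gauss (\<i> * of_real b) (of_real c))"
proof (rule Bochner_Integration.integrable_bound)
  show "integrable lborel (\<lambda>x. exp c * sqrt (2 * pi) * std_normal_density x)" by simp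
  show "gauss (\<i> * of_real b) (of_real c) \<in> borel_measurable lborel"
    using borel_measurable_continuous_onI[OF smooth_nth_deriv_continuous[OF smooth_gauss, of UNIV 0]] by simp
qed (simp add: norm_gauss_imaginary std_normal_density_def)

text \<open>Modulation by \<open>b\<close> turns into translation by \<open>b\<close>. The term
  -b^2/2 appears on expanding -(\<xi> - b)^2/2 into the form required by
  \<open>gauss\<close>.\<close>

lemma fourier_gauss:
  "fourier (gauss (\<i> * of_real b) (of_real c)) = gauss (of_real b) (of_real (c + ln (sqrt (2 * pi)) - b\<^sup>2 / 2))"
proof (rule ext)
  fix \<xi>
  have pos: "sqrt (2 * pi) > 0" by simp
  have "fourier (gauss (\<i> * of_real b) (of_real c)) \<xi>
     = (LINT x|lborel. of_real (exp c * sqrt (2 * pi)) * (of_real (std_normal_density x) * exp (- (\<i> * of_real (x * (\<xi> - b))))))"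
    unfolding fourier_def
  proof (intro Bochner_Integration.integral_cong refl)
    fix x
    have "gauss (\<i> * of_real b) (of_real c) x * exp (- (\<i> * of_real (x * \<xi>)))
      = exp (of_real c + (of_real (- x\<^sup>2 / 2) + - (\<i> * of_real (x * (\<xi> - b)))))"
      unfolding gauss_def exp_add[symmetric] by (intro arg_cong[where f = exp]) (simp add: algebra_simps)
    also have "\<dots> = of_real (exp c) * (of_real (exp (- x\<^sup>2 / 2)) * exp (- (\<i> * of_real (x * (\<xi> - b)))))"
      by (simp only: exp_add exp_of_real)
    finally show "gauss (\<i> * of_real b) (of_real c) x * exp (- (\<i> * of_real (x * \<xi>)))
      = of_real (exp c * sqrt (2 * pi)) * (of_real (std_normal_density x) * exp (- (\<i> * of_real (x * (\<xi> - b)))))"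
      using pos by (simp add: std_normal_density_def)
  qed
  also have "\<dots> = of_real (exp c * sqrt (2 * pi)) * fourier (\<lambda>x. of_real (std_normal_density x)) (\<xi> - b)"
    unfolding fourier_def by (rule integral_mult_right_zero)
  also have "\<dots> = of_real (exp c * exp (ln (sqrt (2 * pi))) * exp (- (\<xi> - b)\<^sup>2 / 2))"
    unfolding fourier_std_normal_density using pos by (simp only: exp_ln of_real_mult)
  also have "exp c * exp (ln (sqrt (2 * pi))) * exp (- (\<xi> - b)\<^sup>2 / 2)
     = exp (c + ln (sqrt (2 * pi)) - b\<^sup>2 / 2 + b * \<xi> - \<xi>\<^sup>2 / 2)"
    unfolding exp_add[symmetric] by (intro arg_cong[where f = exp]) (simp add: power2_eq_square field_simps)
  also have "of_real \<dots> = gauss (of_real b) (of_real (c + ln (sqrt (2 * pi)) - b\<^sup>2 / 2)) \<xi>"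
    unfolding gauss_def exp_of_real[symmetric] by simp
  finally show "fourier (gauss (\<i> * of_real b) (of_real c)) \<xi>
    = gauss (of_real b) (of_real (c + ln (sqrt (2 * pi)) - b\<^sup>2 / 2)) \<xi>" .
qed

text \<open>The radius \<open>r\<close> is kept apart from \<open>z\<close> because the argument is
  estimated by b + |x| on one side of the transform and by |b - \<xi>| on the other.\<close>

lemma poly_norm_le_power:
  fixes p :: "complex poly"
  shows "\<exists>C>0. \<exists>n. \<forall>z r. norm z \<le> r \<longrightarrow> norm (poly p z) \<le> C * (1 + r) ^ n"
proof (induction p)
  case 0
  show ?case by (intro exI[of _ 1] exI[of _ 0] conjI) auto
next
  case (pCons a p)
  then obtain C n where C: "C > 0" "\<And>z r. norm z \<le> r \<Longrightarrow> norm (poly p z) \<le> C * (1 + r) ^ n" by blast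
  show ?case
  proof (intro exI[of _ "norm a + C"] exI[of _ "Suc n"] conjI allI impI)
    show "norm a + C > 0" using C(1) by (simp add: add_nonneg_pos)
    fix z :: complex and r :: real assume zr: "norm z \<le> r"
    then have r: "r \<ge> 0" using norm_ge_zero order_trans by blast
    have "norm (poly (pCons a p) z) \<le> norm a + norm z * norm (poly p z)"
      by (simp add: norm_mult[symmetric] norm_triangle_ineq)
    also have "\<dots> \<le> norm a * (1 + r) ^ Suc n + (1 + r) * (C * (1 + r) ^ n)"
    proof (intro add_mono mult_mono C(2) zr)
      have "norm a * 1 \<le> norm a * (1 + r) ^ Suc n"
        using r by (intro mult_left_mono one_le_power) auto
      then show "norm a \<le> norm a * (1 + r) ^ Suc n" by simp
    qed (use zr r C in auto)
    also have "\<dots> = (norm a + C) * (1 + r) ^ Suc n" by (simp add: algebra_simps)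
    finally show "norm (poly (pCons a p) z) \<le> (norm a + C) * (1 + r) ^ Suc n" .
  qed
qed

section \<open>Seminorms and the topology\<close>

lemma gs_seminorm_leI:
  assumes "\<And>x. norm (nth_deriv j f x) * exp (l * \<omega> \<bar>x\<bar>) \<le> M"
    and "\<And>\<xi>. norm (nth_deriv j (fourier f) \<xi>) * exp (l * \<omega> \<bar>\<xi>\<bar>) \<le> M"
  shows "gs_seminorm \<omega> l j f \<le> ennreal M"
  unfolding gs_seminorm_def using assms by (intro max.boundedI SUP_least ennreal_leI)

lemma gs_seminorm_upper:
  "ennreal (norm (nth_deriv j f x) * exp (l * \<omega> \<bar>x\<bar>)) \<le> gs_seminorm \<omega> l j f"
  "ennreal (norm (nth_deriv j (fourier f) x) * exp (l * \<omega> \<bar>x\<bar>)) \<le> gs_seminorm \<omega> l j f"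
  unfolding gs_seminorm_def by (intro max.coboundedI1 max.coboundedI2 SUP_upper; simp)+

lemma gs_seminorm_leD:
  assumes "gs_seminorm \<omega> l j f \<le> ennreal M" "M \<ge> 0"
  shows "norm (nth_deriv j f x) \<le> M * exp (- l * \<omega> \<bar>x\<bar>)"
    and "norm (nth_deriv j (fourier f) x) \<le> M * exp (- l * \<omega> \<bar>x\<bar>)"
proof -
  have "norm (nth_deriv j f x) * exp (l * \<omega> \<bar>x\<bar>) \<le> M"
    "norm (nth_deriv j (fourier f) x) * exp (l * \<omega> \<bar>x\<bar>) \<le> M"
    using gs_seminorm_upper[THEN order_trans, OF assms(1)] assms(2) by simp_all
  then show "norm (nth_deriv j f x) \<le> M * exp (- l * \<omega> \<bar>x\<bar>)"
    "norm (nth_deriv j (fourier f) x) \<le> M * exp (- l * \<omega> \<bar>x\<bar>)"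
    by (simp_all add: exp_minus field_simps)
qed

text \<open>The form \<open>0 - g\<close> is what the topology provides: it is what is controlled
  when the zero function lies in a subbasic set centred at \<open>g\<close>.\<close>

lemma gs_seminorm_diff:
  assumes "f \<in> gelfand_shilov \<omega>" "g \<in> gelfand_shilov \<omega>"
  shows "gs_seminorm \<omega> l j (\<lambda>x. f x - g x) \<le> gs_seminorm \<omega> l j f + gs_seminorm \<omega> l j (\<lambda>x. 0 - g x)"
proof -
  have S: "integrable lborel f" "smooth f" "smooth (fourier f)"
    "integrable lborel g" "smooth g" "smooth (fourier g)"
    using assms by (auto simp: gelfand_shilov_def)
  have F0: "fourier (\<lambda>x. 0) = (\<lambda>x. 0)" by (simp add: fourier_def fun_eq_iff)
  have le: "ennreal (norm (a - b) * e) \<le> X + Y"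
    if "ennreal (norm a * e) \<le> X" "ennreal (norm (0 - b) * e) \<le> Y" "e \<ge> 0" for a b :: complex and e X Y
  proof -
    have "ennreal (norm (a - b) * e) \<le> ennreal (norm a * e + norm (0 - b) * e)"
      using that(3) norm_triangle_ineq4[of a b]
      by (intro ennreal_leI) (simp add: mult_right_mono flip: distrib_right)
    also have "\<dots> \<le> X + Y" using that by (simp add: add_mono)
    finally show ?thesis .
  qed
  have Z: "nth_deriv j (\<lambda>x. 0 :: complex) = (\<lambda>x. 0)"
    using nth_deriv_diff[OF smooth_zero smooth_zero, of j] by simp
  have D0: "nth_deriv j (\<lambda>x. 0 - g x) = (\<lambda>x. 0 - nth_deriv j g x)" if "smooth g" for g :: "real \<Rightarrow> complex"
    using nth_deriv_diff[OF smooth_zero that, of j] Z by simp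
  note eq = fourier_diff[OF S(1,4)] fourier_diff[OF integrable_zero S(4)] F0
    nth_deriv_diff[OF S(2,5)] nth_deriv_diff[OF S(3,6)] D0[OF S(5)] D0[OF S(6)]
  note upper = gs_seminorm_upper[of j f] gs_seminorm_upper[of j "\<lambda>x. 0 - g x", unfolded eq]
  show ?thesis
    unfolding gs_seminorm_def[of \<omega> l j "\<lambda>x. f x - g x"] eq
    by (intro max.boundedI SUP_least le upper) auto
qed

lemma zero_in_gelfand_shilov: "(\<lambda>x. 0) \<in> gelfand_shilov \<omega>"
proof -
  have F0: "fourier (\<lambda>x. 0) = (\<lambda>x. 0)" by (simp add: fourier_def fun_eq_iff)
  have D0: "nth_deriv j (\<lambda>x. 0 :: complex) = (\<lambda>x. 0)" for j
    using nth_deriv_diff[OF smooth_zero smooth_zero, of j] by simp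
  show ?thesis by (simp add: gelfand_shilov_def gs_seminorm_def F0 D0 smooth_zero)
qed

text \<open>On the x side \<open>b\<close> enters only through the polynomial in front, and a power
  of 1 + b is at most a multiple of exp(\<omega>(b)). On the frequency side the bump sits at
  \<open>b\<close>, where the weight itself has size about exp(l \<omega>(b)), up to the constant in
  \<open>weight_add\<close>.\<close>

lemma gs_seminorm_gauss:
  assumes "weight \<omega>" "l > 0"
  shows "\<exists>C>0. \<exists>L. \<forall>b\<ge>0. \<forall>c. gs_seminorm \<omega> l j (gauss (\<i> * of_real b) (of_real c)) \<le> ennreal (C * exp (c + L * \<omega> b))"
proof -
  have nonneg: "\<omega> t \<ge> 0" if "t \<ge> 0" for t using assms that by (auto simp: weight_def)
  obtain p where p: "\<And>\<beta> \<gamma>. nth_deriv j (gauss \<beta> \<gamma>) = (\<lambda>x. poly p (\<beta> - of_real x) * gauss \<beta> \<gamma> x)"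
    using nth_deriv_gauss by blast
  obtain P n where P: "P > 0" "\<And>z r. norm z \<le> r \<Longrightarrow> norm (poly p z) \<le> P * (1 + r) ^ n"
    using poly_norm_le_power by blast
  obtain K where K: "K \<ge> 1" "\<And>s t. \<omega> \<bar>s + t\<bar> \<le> K * (\<omega> \<bar>s\<bar> + \<omega> \<bar>t\<bar> + 1)"
    using weight_add[OF assms(1)] by blast
  obtain C1 where C1: "C1 > 0" "\<And>t. t \<ge> 0 \<Longrightarrow> (1 + t) ^ n \<le> C1 * exp (\<omega> t)"
    using power_le_exp_weight[OF assms(1)] by blast
  obtain C2 where C2: "C2 > 0" "\<And>x. (1 + \<bar>x\<bar>) ^ n * exp (- x\<^sup>2 / 2) * exp (l * \<omega> \<bar>x\<bar>) \<le> C2"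
    using gaussian_beats_weight[OF assms(1), of l] assms(2) by force
  obtain C3 where C3: "C3 > 0" "\<And>x. (1 + \<bar>x\<bar>) ^ n * exp (- x\<^sup>2 / 2) * exp (l * K * \<omega> \<bar>x\<bar>) \<le> C3"
    using gaussian_beats_weight[OF assms(1), of "l * K"] assms(2) K(1) by force
  \<comment> \<open>The x side needs exponent 1, the frequency side \<open>l * K\<close>; the sum
    serves both.\<close>
  define L where "L = l * K + 1"
  define A where "A = P * C1 * C2"
  define B where "B = P * sqrt (2 * pi) * exp (l * K) * C3"
  have AB: "A > 0" "B > 0" using P(1) C1(1) C2(1) C3(1) by (auto simp: A_def B_def)
  have "gs_seminorm \<omega> l j (gauss (\<i> * of_real b) (of_real c)) \<le> ennreal ((A + B) * exp (c + L * \<omega> b))"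
    if b: "b \<ge> 0" for b c
  proof (rule gs_seminorm_leI)
    fix x
    have "norm (nth_deriv j (gauss (\<i> * of_real b) (of_real c)) x) * exp (l * \<omega> \<bar>x\<bar>)
      = norm (poly p (\<i> * of_real b - of_real x)) * (exp c * exp (- x\<^sup>2 / 2) * exp (l * \<omega> \<bar>x\<bar>))"
      by (simp add: p norm_mult norm_gauss_imaginary)
    also have "\<dots> \<le> (P * (C1 * exp (\<omega> b) * (1 + \<bar>x\<bar>) ^ n)) * (exp c * exp (- x\<^sup>2 / 2) * exp (l * \<omega> \<bar>x\<bar>))"
    proof (intro mult_right_mono)
      have "norm (\<i> * of_real b - of_real x) \<le> b + \<bar>x\<bar>"
        using norm_triangle_ineq4[of "\<i> * of_real b" "of_real x"] b by (simp add: norm_mult)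
      then have "norm (poly p (\<i> * of_real b - of_real x)) \<le> P * (1 + (b + \<bar>x\<bar>)) ^ n" by (rule P(2))
      also have "\<dots> \<le> P * ((1 + b) * (1 + \<bar>x\<bar>)) ^ n"
        using P(1) b by (intro mult_left_mono power_mono) (auto simp: algebra_simps)
      also have "\<dots> \<le> P * (C1 * exp (\<omega> b) * (1 + \<bar>x\<bar>) ^ n)"
        unfolding power_mult_distrib using P(1) b by (intro mult_left_mono mult_right_mono C1(2)) auto
      finally show "norm (poly p (\<i> * of_real b - of_real x)) \<le> P * (C1 * exp (\<omega> b) * (1 + \<bar>x\<bar>) ^ n)" .
    qed auto
    also have "\<dots> = (P * C1 * exp (\<omega> b) * exp c) * ((1 + \<bar>x\<bar>) ^ n * exp (- x\<^sup>2 / 2) * exp (l * \<omega> \<bar>x\<bar>))"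
      by (simp only: mult_ac)
    also have "\<dots> \<le> (P * C1 * exp (\<omega> b) * exp c) * C2"
      using P(1) C1(1) by (intro mult_left_mono C2(2)) auto
    also have "\<dots> = A * exp (c + 1 * \<omega> b)" by (simp add: A_def exp_add mult_ac)
    also have "\<dots> \<le> (A + B) * exp (c + L * \<omega> b)"
    proof -
      have "0 \<le> l * K * \<omega> b" using assms(2) K(1) nonneg[OF b] by simp
      then show ?thesis using AB by (intro mult_mono) (auto simp: L_def algebra_simps)
    qed
    finally show "norm (nth_deriv j (gauss (\<i> * of_real b) (of_real c)) x) * exp (l * \<omega> \<bar>x\<bar>) \<le> (A + B) * exp (c + L * \<omega> b)" .
  next
    fix \<xi>
    have "exp (c + ln (sqrt (2 * pi)) - b\<^sup>2 / 2 + b\<^sup>2 / 2) = sqrt (2 * pi) * exp c"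
      by (simp add: exp_add)
    then have "norm (nth_deriv j (fourier (gauss (\<i> * of_real b) (of_real c))) \<xi>) * exp (l * \<omega> \<bar>\<xi>\<bar>)
      = norm (poly p (of_real b - of_real \<xi>)) * (sqrt (2 * pi) * exp c * exp (- (b - \<xi>)\<^sup>2 / 2) * exp (l * \<omega> \<bar>\<xi>\<bar>))"
      by (simp only: fourier_gauss p norm_mult norm_gauss_real mult_ac)
    also have "\<dots> \<le> (P * (1 + \<bar>b - \<xi>\<bar>) ^ n) * (sqrt (2 * pi) * exp c * exp (- (b - \<xi>)\<^sup>2 / 2) * (exp (l * K * \<omega> \<bar>b - \<xi>\<bar>) * exp (l * K * \<omega> b) * exp (l * K)))"
    proof (intro mult_mono order_refl)
      show "norm (poly p (of_real b - of_real \<xi>)) \<le> P * (1 + \<bar>b - \<xi>\<bar>) ^ n"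
        by (rule P(2)) (simp flip: of_real_diff)
      \<comment> \<open>Splitting \<xi> as (\<xi> - b) + b separates the weight at the centre of the
        bump, which gives the growth in \<open>b\<close>, from the weight at the distance to the
        centre, which the Gaussian absorbs.\<close>
      have "l * \<omega> \<bar>\<xi>\<bar> \<le> l * (K * (\<omega> \<bar>b - \<xi>\<bar> + \<omega> b + 1))"
        using K(2)[of "\<xi> - b" b] assms(2) b by (intro mult_left_mono) (auto simp: abs_minus_commute)
      then show "exp (l * \<omega> \<bar>\<xi>\<bar>) \<le> exp (l * K * \<omega> \<bar>b - \<xi>\<bar>) * exp (l * K * \<omega> b) * exp (l * K)"
        by (simp add: algebra_simps flip: exp_add)
    qed (use P(1) in auto)
    also have "\<dots> = (P * sqrt (2 * pi) * exp c * exp (l * K * \<omega> b) * exp (l * K)) *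
        ((1 + \<bar>b - \<xi>\<bar>) ^ n * exp (- (b - \<xi>)\<^sup>2 / 2) * exp (l * K * \<omega> \<bar>b - \<xi>\<bar>))"
      by (simp only: mult_ac)
    also have "\<dots> \<le> (P * sqrt (2 * pi) * exp c * exp (l * K * \<omega> b) * exp (l * K)) * C3"
      using P(1) by (intro mult_left_mono C3(2)) auto
    also have "\<dots> = B * exp (c + l * K * \<omega> b)" by (simp add: B_def exp_add mult_ac)
    also have "\<dots> \<le> (A + B) * exp (c + L * \<omega> b)"
      using AB nonneg[OF b] by (intro mult_mono) (auto simp: L_def algebra_simps)
    finally show "norm (nth_deriv j (fourier (gauss (\<i> * of_real b) (of_real c))) \<xi>) * exp (l * \<omega> \<bar>\<xi>\<bar>) \<le> (A + B) * exp (c + L * \<omega> b)" .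
  qed
  then show ?thesis using AB by (intro exI[of _ "A + B"] conjI exI[of _ L]) auto
qed

lemma gauss_in_gelfand_shilov:
  assumes "weight \<omega>" "b \<ge> 0"
  shows "gauss (\<i> * of_real b) (of_real c) \<in> gelfand_shilov \<omega>"
proof -
  have "gs_seminorm \<omega> l j (gauss (\<i> * of_real b) (of_real c)) < \<infinity>" if l: "l > 0" for l j
  proof -
    obtain C L where "gs_seminorm \<omega> l j (gauss (\<i> * of_real b) (of_real c)) \<le> ennreal (C * exp (c + L * \<omega> b))"
      using gs_seminorm_gauss[OF assms(1) l, of j] assms(2) by blast
    also have "\<dots> < \<infinity>" by simp
    finally show ?thesis .
  qed
  then show ?thesis
    by (simp add: gelfand_shilov_def integrable_gauss_imaginary smooth_gauss fourier_gauss)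
qed

text \<open>The subbasic sets need not be centred at zero, so the argument follows the generation of
  the open set. Claiming membership beyond thresholds, not for single values of \<open>c\<close> and
  \<open>L\<close>, lets the claim pass to finite intersections.\<close>

lemma openin_gs_topology_absorbs_gauss:
  assumes w: "weight \<omega>" and V: "openin (gs_topology \<omega>) V" "(\<lambda>x. 0) \<in> V"
  shows "\<exists>c0 L0. \<forall>b\<ge>0. \<forall>c\<le>c0. \<forall>L\<ge>L0. gauss (\<i> * of_real b) (of_real (c - L * \<omega> b)) \<in> V"
proof -
  have nonneg: "\<omega> t \<ge> 0" if "t \<ge> 0" for t using w that by (auto simp: weight_def)
  have "generate_topology_on {{g \<in> gelfand_shilov \<omega>. gs_seminorm \<omega> l j (\<lambda>x. g x - f x) < ennreal e} |f l j e.
        f \<in> gelfand_shilov \<omega> \<and> 0 < l \<and> 0 < e} V"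
    using V(1) unfolding gs_topology_def by (rule openin_topology_generated_by)
  then show ?thesis using V(2)
  proof (induction rule: generate_topology_on.induct)
    case Empty
    then show ?case by simp
  next
    case (Int V1 V2)
    then obtain c1 L1 c2 L2 where
      "\<forall>b\<ge>0. \<forall>c\<le>c1. \<forall>L\<ge>L1. gauss (\<i> * of_real b) (of_real (c - L * \<omega> b)) \<in> V1"
      "\<forall>b\<ge>0. \<forall>c\<le>c2. \<forall>L\<ge>L2. gauss (\<i> * of_real b) (of_real (c - L * \<omega> b)) \<in> V2"
      by (metis Int_iff)
    then show ?case by (intro exI[of _ "min c1 c2"] exI[of _ "max L1 L2"]) auto
  next
    case (UN \<K>)
    then show ?case by (meson Union_iff)
  next
    case (Basis s)
    then obtain f l j e where s: "s = {g \<in> gelfand_shilov \<omega>. gs_seminorm \<omega> l j (\<lambda>x. g x - f x) < ennreal e}"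
      and f: "f \<in> gelfand_shilov \<omega>" and l: "l > 0" and e: "e > 0" by auto
    have q: "gs_seminorm \<omega> l j (\<lambda>x. 0 - f x) < ennreal e" using Basis.prems s by simp
    then obtain r where r: "r \<ge> 0" "gs_seminorm \<omega> l j (\<lambda>x. 0 - f x) = ennreal r" "r < e"
      by (cases "gs_seminorm \<omega> l j (\<lambda>x. 0 - f x)" rule: ennreal_cases) (auto simp: ennreal_less_iff)
    obtain C L0 where C: "C > 0" "\<And>b c. b \<ge> 0 \<Longrightarrow>
        gs_seminorm \<omega> l j (gauss (\<i> * of_real b) (of_real c)) \<le> ennreal (C * exp (c + L0 * \<omega> b))"
      using gs_seminorm_gauss[OF w l, of j] by blast
    \<comment> \<open>Here \<open>r\<close> is the distance from zero to the centre
      \<open>f\<close>, and C exp(c0) is half of the slack e - r.\<close>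
    define c0 where "c0 = ln ((e - r) / (2 * C))"
    have "gauss (\<i> * of_real b) (of_real (c - L * \<omega> b)) \<in> s" if b: "b \<ge> 0" "c \<le> c0" "L \<ge> L0" for b c L
    proof -
      let ?g = "gauss (\<i> * of_real b) (of_real (c - L * \<omega> b))"
      have g: "?g \<in> gelfand_shilov \<omega>" by (rule gauss_in_gelfand_shilov[OF w b(1)])
      \<comment> \<open>The scalar factor exp(-L \<omega>(b)) cancels the growth of the seminorm,
        uniformly in \<open>b\<close>.\<close>
      have "L0 * \<omega> b \<le> L * \<omega> b" using b nonneg by (intro mult_right_mono) auto
      then have "C * exp (c - L * \<omega> b + L0 * \<omega> b) \<le> C * exp c0"
        using C(1) b by (intro mult_left_mono) auto
      also have "\<dots> = (e - r) / 2" using C(1) r by (simp add: c0_def)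
      finally have "gs_seminorm \<omega> l j ?g \<le> ennreal ((e - r) / 2)"
        using C(2)[OF b(1), of "c - L * \<omega> b"] by (meson ennreal_leI order_trans)
      then have "gs_seminorm \<omega> l j (\<lambda>x. ?g x - f x) \<le> ennreal ((e - r) / 2) + ennreal r"
        using gs_seminorm_diff[OF g f, of l j] unfolding r(2) by (meson add_right_mono order_trans)
      also have "\<dots> = ennreal ((e - r) / 2 + r)" using r by simp
      also have "\<dots> < ennreal e" using r by (subst ennreal_less_iff) (auto simp: field_simps)
      finally show ?thesis using g s by simp
    qed
    then show ?case by blast
  qed
qed

text \<open>The balls \<open>W n\<close> around zero exhaust the space and increase with n, so
  finitely many of them cover the compact closure and the largest one bounds
  \<open>A\<close>.\<close>

lemma relatively_compactin_gs_topology_bounded: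
  assumes A: "relatively_compactin (gs_topology \<omega>) A" and l: "l > 0"
  shows "\<exists>N\<ge>0. \<forall>g\<in>A. gs_seminorm \<omega> l j g \<le> ennreal N"
proof -
  let ?cl = "gs_topology \<omega> closure_of A"
  define W where "W = (\<lambda>n::nat. {g \<in> gelfand_shilov \<omega>. gs_seminorm \<omega> l j (\<lambda>x. g x - 0) < ennreal (real (Suc n))})"
  have "openin (gs_topology \<omega>) (W n)" for n
    unfolding gs_topology_def W_def using l
    by (intro topology_generated_by_Basis CollectI exI[of _ "\<lambda>x. 0"] exI[of _ l] exI[of _ j]
        exI[of _ "real (Suc n)"]) (auto simp: zero_in_gelfand_shilov)
  moreover have "?cl \<subseteq> (\<Union>n. W n)"
  proof
    fix g assume "g \<in> ?cl"
    then have g: "g \<in> gelfand_shilov \<omega>"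
      using closure_of_subset_topspace[of "gs_topology \<omega>" A] by (auto simp: topspace_gs_topology)
    then have "gs_seminorm \<omega> l j g < \<infinity>" using l by (simp add: gelfand_shilov_def)
    then obtain r where r: "r \<ge> 0" "gs_seminorm \<omega> l j g = ennreal r"
      by (cases "gs_seminorm \<omega> l j g" rule: ennreal_cases) auto
    obtain n where "r < real n" using reals_Archimedean2 by blast
    then have "ennreal r < ennreal (real (Suc n))" using r by (subst ennreal_less_iff) auto
    then have "g \<in> W n" using g r by (simp add: W_def)
    then show "g \<in> (\<Union>n. W n)" by blast
  qed
  moreover have "compactin (gs_topology \<omega>) ?cl" using A by (simp add: relatively_compactin_def)
  ultimately obtain F where F: "finite F" "F \<subseteq> range W" "?cl \<subseteq> \<Union>F"
    unfolding compactin_def by (metis (no_types, lifting) imageE)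
  then obtain I where I: "finite I" "F = W ` I" by (meson finite_subset_image)
  then obtain M where M: "\<And>n. n \<in> I \<Longrightarrow> n \<le> M" by (auto simp: finite_nat_set_iff_bounded_le)
  have "gs_seminorm \<omega> l j g \<le> ennreal (real (Suc M))" if "g \<in> A" for g
  proof -
    have "g \<in> ?cl" using that closure_of_subset A by (auto simp: relatively_compactin_def)
    then obtain n where n: "n \<in> I" "g \<in> W n" using F I by auto
    then have "gs_seminorm \<omega> l j g \<le> ennreal (real (Suc n))" by (auto simp: W_def)
    also have "\<dots> \<le> ennreal (real (Suc M))" using M[OF n(1)] by (intro ennreal_leI) simp
    finally show ?thesis .
  qed
  then show ?thesis by (intro exI[of _ "real (Suc M)"]) auto
qed

section \<open>Decay of the Fourier transform and the derivative\<close>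

text \<open>One factor 1/(1 + x^2) gives integrability; the square keeps another in reserve for
  multiplication by \<xi>, or by \<xi>^2 once the estimate is squared.\<close>

lemma exp_weight_decay:
  assumes "weight \<omega>"
  shows "\<exists>C>0. \<forall>x. exp (- \<omega> \<bar>x\<bar>) \<le> C * (inverse (1 + x\<^sup>2))\<^sup>2"
proof -
  obtain C where C: "C > 0" "\<And>t. t \<ge> 0 \<Longrightarrow> (1 + t) ^ 4 \<le> C * exp (\<omega> t)"
    using power_le_exp_weight[OF assms] by blast
  have "exp (- \<omega> \<bar>x\<bar>) \<le> C * (inverse (1 + x\<^sup>2))\<^sup>2" for x
  proof -
    have pos: "1 + x\<^sup>2 > 0" by (simp add: add_pos_nonneg)
    have "1 + x\<^sup>2 \<le> (1 + \<bar>x\<bar>)\<^sup>2" by (simp add: power2_eq_square algebra_simps)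
    then have "(1 + x\<^sup>2)\<^sup>2 \<le> ((1 + \<bar>x\<bar>)\<^sup>2)\<^sup>2" using pos by (intro power_mono) auto
    also have "\<dots> = (1 + \<bar>x\<bar>) ^ 4" by (simp flip: power_mult)
    also have "\<dots> \<le> C * exp (\<omega> \<bar>x\<bar>)" by (rule C(2)) simp
    finally show ?thesis using pos by (simp add: exp_minus field_simps)
  qed
  with C(1) show ?thesis by blast
qed

lemma gelfand_shilov_decay:
  assumes "weight \<omega>" "g \<in> gelfand_shilov \<omega>"
  shows "\<exists>C\<ge>0. \<forall>x. norm (nth_deriv j g x) \<le> C * (inverse (1 + x\<^sup>2))\<^sup>2
    \<and> norm (nth_deriv j (fourier g) x) \<le> C * (inverse (1 + x\<^sup>2))\<^sup>2"
proof -
  obtain C where C: "C > 0" "\<And>x. exp (- \<omega> \<bar>x\<bar>) \<le> C * (inverse (1 + x\<^sup>2))\<^sup>2"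
    using exp_weight_decay[OF assms(1)] by blast
  have "gs_seminorm \<omega> 1 j g < \<infinity>" using assms(2) by (simp add: gelfand_shilov_def)
  then obtain r where r: "r \<ge> 0" "gs_seminorm \<omega> 1 j g = ennreal r"
    by (cases "gs_seminorm \<omega> 1 j g" rule: ennreal_cases) auto
  have "r * exp (- 1 * \<omega> \<bar>x\<bar>) \<le> r * C * (inverse (1 + x\<^sup>2))\<^sup>2" for x
    using mult_left_mono[OF C(2) r(1)] by (simp add: mult.assoc)
  then have "norm (nth_deriv j g x) \<le> r * C * (inverse (1 + x\<^sup>2))\<^sup>2
    \<and> norm (nth_deriv j (fourier g) x) \<le> r * C * (inverse (1 + x\<^sup>2))\<^sup>2" for x
    using gs_seminorm_leD[OF eq_refl[OF r(2)] r(1), of x] by (meson order_trans)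
  then show ?thesis using r(1) C(1) by (intro exI[of _ "r * C"]) auto
qed

lemma inverse_1_plus_square_bounds:
  "inverse (1 + x\<^sup>2) > 0" "inverse (1 + x\<^sup>2) \<le> 1" "x\<^sup>2 * inverse (1 + x\<^sup>2) \<le> 1"
  "\<bar>x\<bar> * inverse (1 + x\<^sup>2) \<le> 1" for x :: real
proof -
  have pos: "1 + x\<^sup>2 > 0" by (simp add: add_pos_nonneg)
  show "inverse (1 + x\<^sup>2) > 0" "inverse (1 + x\<^sup>2) \<le> 1" "x\<^sup>2 * inverse (1 + x\<^sup>2) \<le> 1"
    using pos by (simp_all add: field_simps)
  have "0 \<le> (2 * \<bar>x\<bar> - 1)\<^sup>2 + 3" by simp
  then have "\<bar>x\<bar> \<le> 1 + x\<^sup>2" by (simp add: power2_eq_square algebra_simps)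
  then show "\<bar>x\<bar> * inverse (1 + x\<^sup>2) \<le> 1" using pos by (simp add: field_simps)
qed

lemma integrable_of_decay:
  fixes f :: "real \<Rightarrow> 'a :: {banach, second_countable_topology}"
  assumes "f \<in> borel_measurable borel" "\<And>x. norm (f x) \<le> C * inverse (1 + x\<^sup>2)"
  shows "integrable lborel f"
proof (rule Bochner_Integration.integrable_bound)
  show "integrable lborel (\<lambda>x::real. C * inverse (1 + x\<^sup>2))"
    using integrable_inverse_1_plus_square_lborel by simp
  show "AE x in lborel. norm (f x) \<le> norm (C * inverse (1 + x\<^sup>2))"
  proof (rule AE_I2)
    fix x show "norm (f x) \<le> norm (C * inverse (1 + x\<^sup>2))"
      using assms(2)[of x] abs_ge_self[of "C * inverse (1 + x\<^sup>2)"] unfolding real_norm_def by linarith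
  qed
qed (use assms in auto)

lemma tendsto_zero_of_decay:
  fixes f :: "real \<Rightarrow> 'a :: real_normed_vector"
  assumes "\<And>x. norm (f x) \<le> C * inverse (1 + x\<^sup>2)"
  shows "(f \<longlongrightarrow> 0) at_top" "(f \<longlongrightarrow> 0) at_bot"
proof -
  have "((\<lambda>x::real. C * inverse (1 + x\<^sup>2)) \<longlongrightarrow> 0) at_top" by real_asymp
  then show "(f \<longlongrightarrow> 0) at_top" by (rule Lim_null_comparison[rotated]) (use assms in auto)
  have "((\<lambda>x::real. C * inverse (1 + x\<^sup>2)) \<longlongrightarrow> 0) at_bot" by real_asymp
  then show "(f \<longlongrightarrow> 0) at_bot" by (rule Lim_null_comparison[rotated]) (use assms in auto)
qed

lemma integrable_square_of_decay:
  fixes f :: "real \<Rightarrow> 'a :: {banach, second_countable_topology}"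
  assumes [measurable]: "f \<in> borel_measurable borel"
    and f: "\<And>x. norm (f x) \<le> C * (inverse (1 + x\<^sup>2))\<^sup>2"
  shows "integrable lborel (\<lambda>x. (norm (f x))\<^sup>2)"
proof (rule integrable_of_decay)
  fix x :: real
  let ?r = "inverse (1 + x\<^sup>2)"
  have "(norm (f x))\<^sup>2 \<le> (C * ?r\<^sup>2)\<^sup>2" using f by (intro power_mono) auto
  also have "\<dots> = C\<^sup>2 * ?r * ?r ^ 3" by (simp add: power_mult_distrib power2_eq_square power3_eq_cube mult_ac)
  also have "\<dots> \<le> C\<^sup>2 * ?r * 1"
    using inverse_1_plus_square_bounds[of x] by (intro mult_left_mono power_le_one) auto
  finally show "norm ((norm (f x))\<^sup>2) \<le> C\<^sup>2 * ?r" by simp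
qed measurable

lemma integrable_gelfand_shilov_square:
  assumes "weight \<omega>" "g \<in> gelfand_shilov \<omega>"
  shows "integrable lborel (\<lambda>x. (norm (nth_deriv j g x))\<^sup>2)"
proof -
  have "smooth g" using assms by (simp add: gelfand_shilov_def)
  from borel_measurable_continuous_onI[OF smooth_nth_deriv_continuous[OF this, of UNIV j]]
  show ?thesis using gelfand_shilov_decay[OF assms, of j] integrable_square_of_decay by metis
qed

text \<open>Plancherel is applied to \<open>g\<close> and to its derivative, whose transform is i
  \<xi> times that of \<open>g\<close>. The spare decay of \<open>fourier g\<close> keeps this
  product integrable.\<close>

lemma plancherel_derivative:
  assumes w: "weight \<omega>" and g: "g \<in> gelfand_shilov \<omega>"
  shows "integrable lborel (\<lambda>\<xi>. \<xi>\<^sup>2 * (norm (fourier g \<xi>))\<^sup>2)"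
    and "integrable lborel (\<lambda>\<xi>. (norm (fourier g \<xi>))\<^sup>2)"
    and "(LINT \<xi>|lborel. (norm (fourier g \<xi>))\<^sup>2) = 2 * pi * (LINT x|lborel. (norm (g x))\<^sup>2)"
    and "(LINT \<xi>|lborel. \<xi>\<^sup>2 * (norm (fourier g \<xi>))\<^sup>2) = 2 * pi * (LINT x|lborel. (norm (nth_deriv 1 g x))\<^sup>2)"
proof -
  have S: "integrable lborel g" "smooth g" "smooth (fourier g)"
    using g by (auto simp: gelfand_shilov_def)
  obtain C0 where C0: "C0 \<ge> 0" "\<And>x. norm (g x) \<le> C0 * (inverse (1 + x\<^sup>2))\<^sup>2"
      "\<And>x. norm (fourier g x) \<le> C0 * (inverse (1 + x\<^sup>2))\<^sup>2"
    using gelfand_shilov_decay[OF w g, of 0] by auto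
  obtain C1 where C1: "C1 \<ge> 0" "\<And>x. norm (nth_deriv 1 g x) \<le> C1 * (inverse (1 + x\<^sup>2))\<^sup>2"
    using gelfand_shilov_decay[OF w g, of 1] by metis
  have cont: "continuous_on UNIV g" "continuous_on UNIV (nth_deriv 1 g)" "continuous_on UNIV (fourier g)"
    using smooth_nth_deriv_continuous[OF S(2), of UNIV 0] smooth_nth_deriv_continuous[OF S(2), of UNIV 1]
      smooth_nth_deriv_continuous[OF S(3), of UNIV 0] by simp_all
  note [measurable] = cont[THEN borel_measurable_continuous_onI]
  have le: "C * (inverse (1 + x\<^sup>2))\<^sup>2 \<le> C * inverse (1 + x\<^sup>2)" "C * (inverse (1 + x\<^sup>2))\<^sup>2 \<le> C"
    if "C \<ge> 0" for C x :: real
  proof -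
    have "inverse (1 + x\<^sup>2) * inverse (1 + x\<^sup>2) \<le> inverse (1 + x\<^sup>2) * 1"
      using inverse_1_plus_square_bounds[of x] by (intro mult_left_mono) auto
    then have "(inverse (1 + x\<^sup>2))\<^sup>2 \<le> inverse (1 + x\<^sup>2)" by (simp add: power2_eq_square)
    then show "C * (inverse (1 + x\<^sup>2))\<^sup>2 \<le> C * inverse (1 + x\<^sup>2)" using that by (rule mult_left_mono)
    show "C * (inverse (1 + x\<^sup>2))\<^sup>2 \<le> C"
      using inverse_1_plus_square_bounds[of x] that by (intro mult_left_le power_le_one) auto
  qed
  have d0: "norm (g x) \<le> C0 * inverse (1 + x\<^sup>2)" "norm (g x) \<le> C0"
    "norm (fourier g x) \<le> C0 * inverse (1 + x\<^sup>2)" for x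
    using C0(2)[of x] C0(3)[of x] le[OF C0(1), of x] by linarith+
  have d1: "norm (nth_deriv 1 g x) \<le> C1 * inverse (1 + x\<^sup>2)" "norm (nth_deriv 1 g x) \<le> C1" for x
    using C1(2)[of x] le[OF C1(1), of x] by linarith+
  have int1: "integrable lborel (nth_deriv 1 g)" 
    by (rule integrable_of_decay[OF cont(2)[THEN borel_measurable_continuous_onI] d1(1)])
  have intF: "integrable lborel (fourier g)" using d0 by (intro integrable_of_decay) auto
  show pl0: "(LINT \<xi>|lborel. (norm (fourier g \<xi>))\<^sup>2) = 2 * pi * (LINT x|lborel. (norm (g x))\<^sup>2)"
    by (rule plancherel[OF S(1) cont(1) d0(2) intF])
  have F1: "fourier (nth_deriv 1 g) \<xi> = \<i> * of_real \<xi> * fourier g \<xi>" for \<xi>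
    using smooth_has_vector_derivative[OF S(2), of 0]
    by (intro fourier_derivative[OF S(1) int1 _ cont(2)] tendsto_zero_of_decay[OF d0(1)]) auto
  then have F1': "fourier (nth_deriv 1 g) = (\<lambda>\<xi>. \<i> * of_real \<xi> * fourier g \<xi>)" by (rule ext)
  have intF1: "integrable lborel (fourier (nth_deriv 1 g))"
  proof (rule integrable_of_decay)
    show "fourier (nth_deriv 1 g) \<in> borel_measurable borel" unfolding F1' by measurable
    fix x :: real
    have "norm (fourier (nth_deriv 1 g) x) \<le> \<bar>x\<bar> * (C0 * (inverse (1 + x\<^sup>2))\<^sup>2)"
      unfolding F1 norm_mult using C0(3)[of x] by (simp add: mult_left_mono)
    also have "\<dots> = C0 * inverse (1 + x\<^sup>2) * (\<bar>x\<bar> * inverse (1 + x\<^sup>2))"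
      by (simp add: power2_eq_square mult_ac)
    also have "\<dots> \<le> C0 * inverse (1 + x\<^sup>2) * 1"
      using C0(1) inverse_1_plus_square_bounds[of x] by (intro mult_left_mono) auto
    finally show "norm (fourier (nth_deriv 1 g) x) \<le> C0 * inverse (1 + x\<^sup>2)" by simp
  qed
  have sq: "(norm (fourier (nth_deriv 1 g) \<xi>))\<^sup>2 = \<xi>\<^sup>2 * (norm (fourier g \<xi>))\<^sup>2" for \<xi>
    unfolding F1 by (simp add: norm_mult power_mult_distrib)
  show "(LINT \<xi>|lborel. \<xi>\<^sup>2 * (norm (fourier g \<xi>))\<^sup>2) = 2 * pi * (LINT x|lborel. (norm (nth_deriv 1 g x))\<^sup>2)"
    using plancherel[OF int1 cont(2) d1(2) intF1] unfolding sq .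
  show "integrable lborel (\<lambda>\<xi>. \<xi>\<^sup>2 * (norm (fourier g \<xi>))\<^sup>2)"
  proof (rule integrable_of_decay)
    fix x :: real
    let ?r = "inverse (1 + x\<^sup>2)"
    have "x\<^sup>2 * (norm (fourier g x))\<^sup>2 \<le> x\<^sup>2 * (C0 * ?r\<^sup>2)\<^sup>2" using C0(3) by (intro mult_left_mono power_mono) auto
    also have "\<dots> = C0\<^sup>2 * ?r * ((x\<^sup>2 * ?r) * ?r\<^sup>2)" by (simp add: power_mult_distrib power2_eq_square mult_ac)
    also have "\<dots> \<le> C0\<^sup>2 * ?r * (1 * 1)"
      using inverse_1_plus_square_bounds[of x] by (intro mult_left_mono mult_mono power_le_one) auto
    finally show "norm (x\<^sup>2 * (norm (fourier g x))\<^sup>2) \<le> C0\<^sup>2 * ?r" by simp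
  qed measurable
  show "integrable lborel (\<lambda>\<xi>. (norm (fourier g \<xi>))\<^sup>2)"
    by (rule integrable_square_of_decay[OF cont(3)[THEN borel_measurable_continuous_onI] C0(3)])
qed

text \<open>Frequencies below \<open>R\<close> contribute at most \<open>R\<^sup>2\<close> times the \<open>L\<^sup>2\<close> norm of \<open>g\<close>; the tail
  is absorbed by the weighted bound on the Fourier transform.\<close>

lemma derivative_L2_bound:
  assumes w: "weight \<omega>"
  shows "\<exists>D>0. \<forall>g\<in>gelfand_shilov \<omega>. \<forall>N \<mu> R. \<mu> \<ge> 0 \<longrightarrow> R \<ge> 0 \<longrightarrow>
     (\<forall>\<xi>. norm (fourier g \<xi>) \<le> N * exp (- (\<mu> + 1) * \<omega> \<bar>\<xi>\<bar>)) \<longrightarrow>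
     (LINT x|lborel. (norm (nth_deriv 1 g x))\<^sup>2)
       \<le> R\<^sup>2 * (LINT x|lborel. (norm (g x))\<^sup>2) + D * (N * exp (- \<mu> * \<omega> R))\<^sup>2"
proof -
  have mono: "mono_on {0..} \<omega>" using w by (auto simp: weight_def)
  obtain C where C: "C > 0" "\<And>x. exp (- \<omega> \<bar>x\<bar>) \<le> C * (inverse (1 + x\<^sup>2))\<^sup>2"
    using exp_weight_decay[OF w] by blast
  define I where "I = (LINT x|lborel. inverse (1 + x\<^sup>2 :: real))"
  have I: "I \<ge> 0" unfolding I_def using inverse_1_plus_square_bounds(1) by (intro integral_nonneg_AE AE_I2) (rule less_imp_le)
  define D where "D = C\<^sup>2 * (I + 1)"
  have D: "D > 0" using C I by (simp add: D_def)
  have "(LINT x|lborel. (norm (nth_deriv 1 g x))\<^sup>2)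
       \<le> R\<^sup>2 * (LINT x|lborel. (norm (g x))\<^sup>2) + D * (N * exp (- \<mu> * \<omega> R))\<^sup>2"
    if g: "g \<in> gelfand_shilov \<omega>" and \<mu>: "\<mu> \<ge> 0" and R: "R \<ge> 0"
      and le: "\<And>\<xi>. norm (fourier g \<xi>) \<le> N * exp (- (\<mu> + 1) * \<omega> \<bar>\<xi>\<bar>)" for g N \<mu> R
  proof -
    note P = plancherel_derivative[OF w g]
    let ?M = "(N * exp (- \<mu> * \<omega> R))\<^sup>2 * C\<^sup>2"
    \<comment> \<open>The sign of \<open>N\<close> is read off from the assumed bound at frequency
      0.\<close>
    have "0 \<le> N * exp (- (\<mu> + 1) * \<omega> \<bar>0\<bar>)" using le[of 0] norm_ge_zero order_trans by blast
    then have N: "N \<ge> 0" by (simp add: zero_le_mult_iff)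
    have pw: "\<xi>\<^sup>2 * (norm (fourier g \<xi>))\<^sup>2 \<le> R\<^sup>2 * (norm (fourier g \<xi>))\<^sup>2 + ?M * inverse (1 + \<xi>\<^sup>2)" for \<xi>
    proof (cases "\<bar>\<xi>\<bar> \<le> R")
      case True
      then have "\<xi>\<^sup>2 \<le> R\<^sup>2" using abs_le_square_iff[of \<xi> R] R by simp
      then have "\<xi>\<^sup>2 * (norm (fourier g \<xi>))\<^sup>2 \<le> R\<^sup>2 * (norm (fourier g \<xi>))\<^sup>2" by (rule mult_right_mono) simp
      moreover have "0 \<le> ?M * inverse (1 + \<xi>\<^sup>2)" by simp
      ultimately show ?thesis by linarith
    next
      case False
      let ?r = "inverse (1 + \<xi>\<^sup>2)"
      have "\<omega> R \<le> \<omega> \<bar>\<xi>\<bar>" using False R by (intro mono_onD[OF mono]) auto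
      then have "\<mu> * \<omega> R \<le> \<mu> * \<omega> \<bar>\<xi>\<bar>" using \<mu> by (rule mult_left_mono)
      \<comment> \<open>The exponent \<mu> + 1 is split: \<mu> is evaluated at the cut-off by
        monotonicity, and the remaining 1 makes the tail integrable.\<close>
      then have "N * exp (- (\<mu> + 1) * \<omega> \<bar>\<xi>\<bar>) \<le> N * (exp (- \<mu> * \<omega> R) * exp (- \<omega> \<bar>\<xi>\<bar>))"
        using N by (intro mult_left_mono) (auto simp: algebra_simps simp flip: exp_add)
      also have "\<dots> \<le> N * (exp (- \<mu> * \<omega> R) * (C * ?r\<^sup>2))"
        using N C by (intro mult_left_mono) auto
      finally have "norm (fourier g \<xi>) \<le> N * exp (- \<mu> * \<omega> R) * C * ?r\<^sup>2"
        using le[of \<xi>] by (simp only: mult.assoc)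
      then have "(norm (fourier g \<xi>))\<^sup>2 \<le> (N * exp (- \<mu> * \<omega> R) * C * ?r\<^sup>2)\<^sup>2"
        by (intro power_mono) auto
      also have "\<dots> = ?M * (?r\<^sup>2)\<^sup>2" by (simp only: power_mult_distrib)
      finally have "\<xi>\<^sup>2 * (norm (fourier g \<xi>))\<^sup>2 \<le> \<xi>\<^sup>2 * (?M * (?r\<^sup>2)\<^sup>2)"
        by (intro mult_left_mono) auto
      also have "\<dots> = ?M * ?r * ((\<xi>\<^sup>2 * ?r) * ?r\<^sup>2)" by (simp only: power2_eq_square mult_ac)
      also have "\<dots> \<le> ?M * ?r * (1 * 1)"
        using inverse_1_plus_square_bounds[of \<xi>] by (intro mult_left_mono mult_mono power_le_one) auto
      also have "\<dots> \<le> R\<^sup>2 * (norm (fourier g \<xi>))\<^sup>2 + ?M * ?r" by simp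
      finally show ?thesis .
    qed
    have int: "integrable lborel (\<lambda>\<xi>. R\<^sup>2 * (norm (fourier g \<xi>))\<^sup>2)" "integrable lborel (\<lambda>\<xi>::real. ?M * inverse (1 + \<xi>\<^sup>2))"
      using P(2) integrable_inverse_1_plus_square_lborel by auto
    have "2 * pi * (LINT x|lborel. (norm (nth_deriv 1 g x))\<^sup>2)
       \<le> (LINT \<xi>|lborel. R\<^sup>2 * (norm (fourier g \<xi>))\<^sup>2 + ?M * inverse (1 + \<xi>\<^sup>2))"
      unfolding P(4)[symmetric] by (intro integral_mono P(1) Bochner_Integration.integrable_add int pw)
    also have "\<dots> = R\<^sup>2 * (2 * pi * (LINT x|lborel. (norm (g x))\<^sup>2)) + ?M * I"
      unfolding Bochner_Integration.integral_add[OF int] I_def by (simp add: P(3))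
    \<comment> \<open>The tail is enlarged by 2 pi so that this factor cancels throughout; I + 1
      matches the choice of \<open>D\<close>, made to be positive.\<close>
    also have "?M * I \<le> 2 * pi * (?M * (I + 1))"
    proof -
      have "1 * (?M * I) \<le> 2 * pi * (?M * (I + 1))"
        using pi_ge_two I by (intro mult_mono mult_left_mono) auto
      then show ?thesis by simp
    qed
    finally have "2 * pi * (LINT x|lborel. (norm (nth_deriv 1 g x))\<^sup>2)
       \<le> 2 * pi * (R\<^sup>2 * (LINT x|lborel. (norm (g x))\<^sup>2) + ?M * (I + 1))"
      by (simp add: algebra_simps)
    then have "(LINT x|lborel. (norm (nth_deriv 1 g x))\<^sup>2) \<le> R\<^sup>2 * (LINT x|lborel. (norm (g x))\<^sup>2) + ?M * (I + 1)"
      using pi_gt_zero by (simp only: mult_le_cancel_left_pos zero_less_mult_iff zero_less_numeral simp_thms)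
    also have "?M * (I + 1) = D * (N * exp (- \<mu> * \<omega> R))\<^sup>2" by (simp only: D_def mult_ac)
    finally show ?thesis .
  qed
  with D show ?thesis by blast
qed

section \<open>Non-compactness of composition operators\<close>

text \<open>If the integral were zero, the zero set would be closed and of full measure, hence the
  whole line.\<close>

lemma integral_continuous_pos:
  fixes k :: "real \<Rightarrow> real"
  assumes "integrable lborel k" "continuous_on UNIV k" "\<And>x. k x \<ge> 0" "k x0 \<noteq> 0"
  shows "(LINT x|lborel. k x) > 0"
proof (rule ccontr)
  assume "\<not> ?thesis"
  moreover have "(LINT x|lborel. k x) \<ge> 0" using assms(3) by (intro integral_nonneg_AE) auto
  ultimately have "(LINT x|lborel. k x) = 0" by simp
  then have "AE x in lborel. k x = 0"
    using assms by (subst (asm) integral_nonneg_eq_0_iff_AE) auto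
  then have "AE x in lebesgue. x \<in> {x. k x = 0}" by (auto intro: AE_completion)
  moreover have "closed {x. k x = 0}"
    using assms(2) by (intro closed_Collect_eq continuous_on_const)
  ultimately show False using mem_closed_if_AE_lebesgue[of "{x. k x = 0}" x0] assms(4) by auto
qed

lemma not_integrable_const_lborel:
  assumes "c \<noteq> (0::real)"
  shows "\<not> integrable lborel (\<lambda>x::real. c)"
  using assms by (simp add: integrable_iff_bounded ennreal_mult_top)

theorem theorem2p2:
  fixes \<omega> :: "real \<Rightarrow> real" and \<psi> :: "real \<Rightarrow> real"
  assumes "strong_weight \<omega>"
    and "smooth \<psi>"
    and "\<And>f. f \<in> gelfand_shilov \<omega> \<Longrightarrow> f \<circ> \<psi> \<in> gelfand_shilov \<omega>"
  shows "\<not> compact_operator (gs_topology \<omega>) (gs_topology \<omega>) (\<lambda>f. f \<circ> \<psi>)"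
proof
  assume "compact_operator (gs_topology \<omega>) (gs_topology \<omega>) (\<lambda>f. f \<circ> \<psi>)"
  then obtain U V where V: "openin (gs_topology \<omega>) V" "(\<lambda>x. 0) \<in> V" "V \<subseteq> U"
    and U: "relatively_compactin (gs_topology \<omega>) ((\<lambda>f. f \<circ> \<psi>) ` U)"
    unfolding compact_operator_def by blast
  have w: "weight \<omega>" using assms(1) by (simp add: strong_weight_def)
  obtain c0 L0 where c0: "\<And>b c L. b \<ge> 0 \<Longrightarrow> c \<le> c0 \<Longrightarrow> L \<ge> L0 \<Longrightarrow>
      gauss (\<i> * of_real b) (of_real (c - L * \<omega> b)) \<in> V"
    using openin_gs_topology_absorbs_gauss[OF w V(1,2)] by blast
  \<comment> \<open>Nonnegativity is needed for multiplying the dilation inequality by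
    \<open>L\<close> and for \<mu> \<ge> 0.\<close>
  define L where "L = max L0 0"
  define c where "c = (\<lambda>b. c0 - L * \<omega> b)"
  define g where "g = (\<lambda>b. gauss (\<i> * of_real b) (of_real (c b)) \<circ> \<psi>)"
  define E where "E = (\<lambda>x. exp (- (\<psi> x)\<^sup>2 / 2))"
  define \<psi>' where "\<psi>' = nth_deriv 1 \<psi>"
  have L: "L \<ge> 0" by (simp add: L_def)
  have gS: "g b \<in> gelfand_shilov \<omega>" if "b \<ge> 0" for b
    unfolding g_def using assms(3)[OF gauss_in_gelfand_shilov[OF w that]] .
  have gU: "g b \<in> (\<lambda>f. f \<circ> \<psi>) ` U" if "b \<ge> 0" for b
    unfolding g_def c_def using c0[OF that, of c0 L] V(3) by (auto simp: L_def)
  have norm_g: "norm (g b x) = exp (c b) * E x" for b x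
    by (simp add: g_def E_def norm_gauss_imaginary)
  have \<psi>: "(\<psi> has_vector_derivative \<psi>' x) (at x)" for x
    using smooth_has_vector_derivative[OF assms(2), of 0 x] by (simp add: \<psi>'_def)
  have "nth_deriv 1 (g b) x = \<psi>' x *\<^sub>R ((\<i> * of_real b - of_real (\<psi> x)) * gauss (\<i> * of_real b) (of_real (c b)) (\<psi> x))" for b x
    using vector_diff_chain_at[OF \<psi> gauss_has_vector_derivative]
    by (simp add: nth_deriv_Suc g_def vector_derivative_at)
  then have norm_g': "norm (nth_deriv 1 (g b) x) = \<bar>\<psi>' x\<bar> * (norm (\<i> * of_real b - of_real (\<psi> x)) * (exp (c b) * E x))" for b x
    by (simp add: norm_mult norm_gauss_imaginary E_def)
  have g'_ge: "(b * exp (c b))\<^sup>2 * (\<psi>' x * E x)\<^sup>2 \<le> (norm (nth_deriv 1 (g b) x))\<^sup>2" if "b \<ge> 0" for b x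
  proof -
    \<comment> \<open>The imaginary part is exactly \<open>b\<close>; the real part -\<psi>(x) can
      only increase the modulus.\<close>
    have "b \<le> norm (\<i> * of_real b - of_real (\<psi> x))"
      using abs_Im_le_cmod[of "\<i> * of_real b - of_real (\<psi> x)"] that by simp
    then have "\<bar>\<psi>' x\<bar> * (b * (exp (c b) * E x)) \<le> norm (nth_deriv 1 (g b) x)"
      unfolding norm_g' by (intro mult_left_mono mult_right_mono) (auto simp: E_def)
    then have "(\<bar>\<psi>' x\<bar> * (b * (exp (c b) * E x)))\<^sup>2 \<le> (norm (nth_deriv 1 (g b) x))\<^sup>2"
      using that by (intro power_mono) (auto simp: E_def)
    then show ?thesis by (simp add: power_mult_distrib mult_ac)
  qed
  have cont_\<psi>: "continuous_on UNIV \<psi>" "continuous_on UNIV \<psi>'"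
    using smooth_nth_deriv_continuous[OF assms(2), of UNIV 0] smooth_nth_deriv_continuous[OF assms(2), of UNIV 1]
    by (auto simp: \<psi>'_def)
  have cont_k: "continuous_on UNIV (\<lambda>x. (\<psi>' x * E x)\<^sup>2)"
    unfolding E_def by (intro continuous_intros cont_\<psi>) auto
  have int_A: "integrable lborel (\<lambda>x. (E x)\<^sup>2)"
    using integrable_gelfand_shilov_square[OF w gS[of 0], of 0] by (simp add: norm_g power_mult_distrib)
  have int_k: "integrable lborel (\<lambda>x. (\<psi>' x * E x)\<^sup>2)"
  proof -
    \<comment> \<open>The lower bound \<open>g'_ge\<close> at b = 1 makes the derivative of
      \<open>g 1\<close> a majorant; at b = 0 it would be void.\<close>
    have "integrable lborel (\<lambda>x. (1 * exp (c 1))\<^sup>2 * (\<psi>' x * E x)\<^sup>2)"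
    proof (rule Bochner_Integration.integrable_bound)
      show "integrable lborel (\<lambda>x. (norm (nth_deriv 1 (g 1) x))\<^sup>2)"
        by (rule integrable_gelfand_shilov_square[OF w gS]) simp
      show "(\<lambda>x. (1 * exp (c 1))\<^sup>2 * (\<psi>' x * E x)\<^sup>2) \<in> borel_measurable lborel"
        using borel_measurable_continuous_onI[OF cont_k] by measurable
      show "AE x in lborel. norm ((1 * exp (c 1))\<^sup>2 * (\<psi>' x * E x)\<^sup>2) \<le> norm ((norm (nth_deriv 1 (g 1) x))\<^sup>2)"
        using g'_ge[of 1] by (intro AE_I2) simp
    qed
    then show ?thesis by simp
  qed
  define A where "A = (LINT x|lborel. (E x)\<^sup>2)"
  define \<kappa> where "\<kappa> = (LINT x|lborel. (\<psi>' x * E x)\<^sup>2)"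
  have A: "A \<ge> 0" unfolding A_def by (intro integral_nonneg_AE) auto
  \<comment> \<open>Constant \<psi> is excluded at this point, so that \<kappa> is positive and can
    be divided by.\<close>
  have "\<exists>x0. \<psi>' x0 \<noteq> 0"
  proof (rule ccontr)
    assume "\<nexists>x0. \<psi>' x0 \<noteq> 0"
    then obtain d where "\<And>x. \<psi> x = d"
      using has_vector_derivative_zero_constant[of UNIV \<psi>] \<psi> by auto
    then show False using int_A not_integrable_const_lborel[of "(exp (- d\<^sup>2 / 2))\<^sup>2"] by (simp add: E_def)
  qed
  then obtain x0 where "\<psi>' x0 \<noteq> 0" ..
  then have \<kappa>: "\<kappa> > 0"
    unfolding \<kappa>_def by (intro integral_continuous_pos[OF int_k cont_k, of x0]) (auto simp: E_def)
  \<comment> \<open>Chosen so that the low frequencies account for at most half of \<kappa>; A + 1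
    avoids a separate treatment of A = 0.\<close>
  define \<eta> where "\<eta> = sqrt (\<kappa> / (2 * (A + 1)))"
  have \<eta>: "\<eta> > 0" "\<eta>\<^sup>2 * A \<le> \<kappa> / 2" using \<kappa> A by (auto simp: \<eta>_def field_simps)
  obtain C where C: "C \<ge> 1" "\<And>t. t \<ge> 0 \<Longrightarrow> \<omega> t \<le> C * (\<omega> (\<eta> * t) + 1)"
    using weight_dilation[OF w \<eta>(1)] by blast
  \<comment> \<open>By the dilation inequality, exp(-\<mu> \<omega>(\<eta> b)) is then at most a
    constant times exp(-L \<omega>(b)), the same factor as in the normalisation of
    \<open>g b\<close>.\<close>
  define \<mu> where "\<mu> = L * C"
  have \<mu>: "\<mu> \<ge> 0" using L C(1) by (simp add: \<mu>_def)
  \<comment> \<open>Here compactness enters: \<open>U\<close> and \<open>L\<close> are already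
    fixed, yet the image is bounded in the seminorm for this \<mu>.\<close>
  obtain N where N: "N \<ge> 0" "\<And>f. f \<in> (\<lambda>f. f \<circ> \<psi>) ` U \<Longrightarrow> gs_seminorm \<omega> (\<mu> + 1) 0 f \<le> ennreal N"
    using relatively_compactin_gs_topology_bounded[OF U, of "\<mu> + 1" 0] \<mu> by auto
  obtain D where D: "D > 0" "\<And>f N \<mu> R. f \<in> gelfand_shilov \<omega> \<Longrightarrow> \<mu> \<ge> 0 \<Longrightarrow> R \<ge> 0 \<Longrightarrow>
     (\<And>\<xi>. norm (fourier f \<xi>) \<le> N * exp (- (\<mu> + 1) * \<omega> \<bar>\<xi>\<bar>)) \<Longrightarrow>
     (LINT x|lborel. (norm (nth_deriv 1 f x))\<^sup>2)
       \<le> R\<^sup>2 * (LINT x|lborel. (norm (f x))\<^sup>2) + D * (N * exp (- \<mu> * \<omega> R))\<^sup>2"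
    using derivative_L2_bound[OF w] by blast
  \<comment> \<open>What remains of the tail after the common factor exp(c b)^2 is removed; it does
    not depend on \<open>b\<close>.\<close>
  define M where "M = D * (N * exp (\<mu> - c0))\<^sup>2"
  have M: "M \<ge> 0" using D by (simp add: M_def)
  have bound: "b\<^sup>2 * (\<kappa> / 2) \<le> M" if b: "b \<ge> 0" for b
  proof -
    have "(b * exp (c b))\<^sup>2 * \<kappa> = (LINT x|lborel. (b * exp (c b))\<^sup>2 * (\<psi>' x * E x)\<^sup>2)"
      by (simp add: \<kappa>_def)
    also have "\<dots> \<le> (LINT x|lborel. (norm (nth_deriv 1 (g b) x))\<^sup>2)"
      using int_k integrable_gelfand_shilov_square[OF w gS[OF b]] g'_ge[OF b]
      by (intro integral_mono) auto
    also have "\<dots> \<le> (\<eta> * b)\<^sup>2 * (LINT x|lborel. (norm (g b x))\<^sup>2) + D * (N * exp (- \<mu> * \<omega> (\<eta> * b)))\<^sup>2"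
      using gs_seminorm_leD(2)[OF N(2)[OF gU[OF b]] N(1)] \<eta>(1) b
      by (intro D(2) gS[OF b] \<mu>) (auto simp: nth_deriv_0)
    also have "(LINT x|lborel. (norm (g b x))\<^sup>2) = (exp (c b))\<^sup>2 * A"
      by (simp add: norm_g power_mult_distrib A_def)
    also have "D * (N * exp (- \<mu> * \<omega> (\<eta> * b)))\<^sup>2 \<le> (exp (c b))\<^sup>2 * M"
    proof -
      have "L * \<omega> b \<le> L * (C * (\<omega> (\<eta> * b) + 1))" using L C(2)[OF b] by (rule mult_left_mono[rotated])
      then have "exp (- \<mu> * \<omega> (\<eta> * b)) \<le> exp (c b) * exp (\<mu> - c0)"
        by (simp add: c_def \<mu>_def algebra_simps flip: exp_add)
      then have "D * (N * exp (- \<mu> * \<omega> (\<eta> * b)))\<^sup>2 \<le> D * (N * (exp (c b) * exp (\<mu> - c0)))\<^sup>2"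
        using D(1) N(1) by (intro mult_left_mono power_mono) auto
      then show ?thesis by (simp only: M_def power_mult_distrib mult_ac)
    qed
    finally have "(exp (c b))\<^sup>2 * (b\<^sup>2 * \<kappa>) \<le> (exp (c b))\<^sup>2 * (b\<^sup>2 * (\<eta>\<^sup>2 * A) + M)"
      by (simp add: power_mult_distrib algebra_simps)
    then have "b\<^sup>2 * \<kappa> \<le> b\<^sup>2 * (\<eta>\<^sup>2 * A) + M" by (simp add: mult_le_cancel_left_pos)
    moreover have "b\<^sup>2 * (\<eta>\<^sup>2 * A) \<le> b\<^sup>2 * (\<kappa> / 2)" using \<eta>(2) by (intro mult_left_mono) auto
    ultimately show ?thesis by simp
  qed
  \<comment> \<open>At this value of \<open>b\<close> the bound would read M + 1 \<le> M.\<close>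
  have "(sqrt (2 * (M + 1) / \<kappa>))\<^sup>2 * (\<kappa> / 2) = M + 1" using M \<kappa> by simp
  moreover have "sqrt (2 * (M + 1) / \<kappa>) \<ge> 0" using M \<kappa> by simp
  ultimately show False using bound by fastforce
qed

end
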